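(* (i) In the ring $\Lambda_{\mathbb{Q}}[[z]]$, \[\sum_{n\ge0,\ |\lambda|\ge0}\mathrm{HP}(\mathsf{K}_{(1^n)\cup\lambda})\frac{z^n}{n!}\frac{m_\lambda}{\lambda!}=\frac{1}{1-\big(z+\sum_{n\ge1}(-1)^{n-1}p_n\big)}.\] (ii) \[\sum_{n+l(\lambda)\ge2}\mathrm{HC}(\mathsf{K}_{(1^n)\cup\lambda})\frac{z^n}{n!}\frac{m_\lambda}{\lambda!}=-\log\Big(1-\big(z+\sum_{n\ge1}(-1)^{n-1}p_n\big)\Big)+\sum_{n\ge1}(-1)^n\frac{p_n}{n}.\]
   Context: $\Lambda_{\mathbb{Q}}$ is the ring of symmetric functions with rational coefficients (in variables $x_1,x_2,\dots$), $m_\lambda$ the monomial symmetric function of a partition $\lambda=(\lambda_1\ge\dots\ge\lambda_k)$, $p_n=\sum_i x_i^n$ the power sums, $\lambda!=\lambda_1!\cdots\lambda_k!$, $l(\lambda)=k$ the length, $|\lambda|$ the size. Sums range over all partitions $\lambda$, including the empty one. For a partition $\lambda$, the complete multipartite graph $\mathsf{K}_\lambda$ has vertex set a disjoint union of blocks of sizes $\lambda_1,\dots,\lambda_k$, two vertices adjacent iff they lie in different blocks; $(1^n)\cup\lambda$ is $\lambda$ with $n$ extra parts equal to $1$. $\mathrm{HP}(\Gamma)$ is the number of directed Hamiltonian paths (orderings $(v_1,\dots,v_N)$ of all vertices with consecutive vertices adjacent) of a graph $\Gamma$, possibly disconnected; convention: $\mathrm{HP}$ of the empty graph is $1$, of a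 one-vertex graph is $1$. $\mathrm{HC}(\Gamma)$ is the number of directed Hamiltonian cycles (for $\ge3$ vertices: orderings up to rotation with consecutive vertices and last/first adjacent); convention: $\mathrm{HC}(\mathsf{K}_{(1^2)})=1$ for the connected graph on two vertices.
   Formalization: In (ii) the formal right-hand side has an extra summand −z: as printed, the coefficient of z is 0 on the left (n=1, λ empty is excluded by n+l(λ)≥2) but 1 on the right. *)

theory Defs
  imports
    "HOL-Computational_Algebra.Formal_Power_Series"
    "HOL-Library.Poly_Mapping"
    "HOL-Library.Multiset"
begin

unbundle fps_syntax

section \<open>Symmetric functions with rational coefficients\<close>

text \<open>
  Variables are indexed by \<^typ>\<open>nat\<close>; the monomial with exponent vector
  \<open>\<alpha>\<close> is encoded by the finitely supported function \<open>\<alpha> :: nat \<Rightarrow>\<^sub>0 nat\<close>.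
\<close>

type_synonym expo = "nat \<Rightarrow>\<^sub>0 nat"

text \<open>
  An element is a family of coefficients, invariant under permuting the variables. There is no
  bound on the degree: the sums over all partitions only make sense in the
  completion of the ring of symmetric functions with respect to its grading by degree.
\<close>

typedef symf = "{f :: expo \<Rightarrow> rat. \<forall>\<pi> \<alpha>. bij \<pi> \<longrightarrow> f (Poly_Mapping.map_key \<pi> \<alpha>) = f \<alpha>}"
  morphisms scoeff Abs_symf
  by (rule exI[of _ "\<lambda>_. 0"]) simp

setup_lifting type_definition_symf

lemma symf_eqI: "(\<And>\<alpha>. scoeff f \<alpha> = scoeff g \<alpha>) \<Longrightarrow> f = g"
  by (metis ext scoeff_inject)

lemma scoeff_map_key: "bij \<pi> \<Longrightarrow> scoeff f (Poly_Mapping.map_key \<pi> \<alpha>) = scoeff f \<alpha>"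
  using scoeff[of f] by simp

lemma map_key_inverse:
  fixes \<pi> :: "nat \<Rightarrow> nat" and \<alpha> :: expo
  assumes "bij \<pi>"
  shows "Poly_Mapping.map_key \<pi> (Poly_Mapping.map_key (inv \<pi>) \<alpha>) = \<alpha>"
    and "Poly_Mapping.map_key (inv \<pi>) (Poly_Mapping.map_key \<pi> \<alpha>) = \<alpha>"
proof -
  have i: "inj \<pi>" "inj (inv \<pi>)" "surj \<pi>"
    using assms bij_is_inj bij_is_surj bij_imp_bij_inv by blast+
  have c: "inv \<pi> \<circ> \<pi> = (\<lambda>x. x)" "\<pi> \<circ> inv \<pi> = (\<lambda>x. x)"
    using i by (simp_all add: fun_eq_iff surj_f_inv_f)
  show "Poly_Mapping.map_key \<pi> (Poly_Mapping.map_key (inv \<pi>) \<alpha>) = \<alpha>"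
    unfolding map_key_compose[OF i(1,2)] c by (rule map_key_id)
  show "Poly_Mapping.map_key (inv \<pi>) (Poly_Mapping.map_key \<pi> \<alpha>) = \<alpha>"
    unfolding map_key_compose[OF i(2,1)] c by (rule map_key_id)
qed

lemma map_key_eq_0_iff:
  fixes \<pi> :: "nat \<Rightarrow> nat" and \<alpha> :: expo
  assumes "bij \<pi>" shows "Poly_Mapping.map_key \<pi> \<alpha> = 0 \<longleftrightarrow> \<alpha> = 0"
proof
  assume "Poly_Mapping.map_key \<pi> \<alpha> = 0"
  then have "\<alpha> = Poly_Mapping.map_key (inv \<pi>) 0"
    using map_key_inverse(2)[OF assms, of \<alpha>] by simp
  then show "\<alpha> = 0"
    using map_key_zero[OF bij_is_inj[OF bij_imp_bij_inv[OF assms]]] by simp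
next
  assume "\<alpha> = 0"
  then show "Poly_Mapping.map_key \<pi> \<alpha> = 0"
    using map_key_zero[OF bij_is_inj[OF assms]] by simp
qed

definition splits :: "expo \<Rightarrow> (expo \<times> expo) set"
  where "splits \<alpha> = {(\<beta>, \<gamma>). \<beta> + \<gamma> = \<alpha>}"

lemma finite_below: "finite {\<beta> :: expo. \<forall>i. Poly_Mapping.lookup \<beta> i \<le> Poly_Mapping.lookup \<alpha> i}"
proof -
  let ?S = "{\<beta> :: expo. \<forall>i. Poly_Mapping.lookup \<beta> i \<le> Poly_Mapping.lookup \<alpha> i}"
  let ?M = "\<Sum>i\<in>Poly_Mapping.keys \<alpha>. Poly_Mapping.lookup \<alpha> i"
  have M: "Poly_Mapping.lookup \<alpha> i \<le> ?M" for i
    by (cases "i \<in> Poly_Mapping.keys \<alpha>") (auto intro: member_le_sum simp: in_keys_iff)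
  have "Poly_Mapping.lookup ` ?S \<subseteq>
      {f. \<forall>x. (x \<in> Poly_Mapping.keys \<alpha> \<longrightarrow> f x \<in> {..?M}) \<and> (x \<notin> Poly_Mapping.keys \<alpha> \<longrightarrow> f x = 0)}"
    using M by (auto simp: in_keys_iff intro: order_trans) (metis le_zero_eq)
  then have "finite (Poly_Mapping.lookup ` ?S)"
    by (rule finite_subset) (intro finite_set_of_finite_funs; simp)
  then show ?thesis
    by (rule finite_imageD) (simp add: inj_on_def poly_mapping_eqI)
qed

lemma finite_splits: "finite (splits \<alpha>)"
proof -
  let ?S = "{\<beta> :: expo. \<forall>i. Poly_Mapping.lookup \<beta> i \<le> Poly_Mapping.lookup \<alpha> i}"
  have "splits \<alpha> \<subseteq> ?S \<times> ?S"
    by (auto simp: splits_def lookup_add)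
  then show ?thesis
    using finite_below finite_subset by blast
qed

lemma sum_splits_map_key:
  fixes \<pi> :: "nat \<Rightarrow> nat" and f g :: "expo \<Rightarrow> rat"
  assumes b: "bij \<pi>"
    and f: "\<And>\<pi> \<alpha>. bij \<pi> \<Longrightarrow> f (Poly_Mapping.map_key \<pi> \<alpha>) = f \<alpha>"
    and g: "\<And>\<pi> \<alpha>. bij \<pi> \<Longrightarrow> g (Poly_Mapping.map_key \<pi> \<alpha>) = g \<alpha>"
  shows "(\<Sum>(\<beta>, \<gamma>)\<in>splits (Poly_Mapping.map_key \<pi> \<alpha>). f \<beta> * g \<gamma>) = (\<Sum>(\<beta>, \<gamma>)\<in>splits \<alpha>. f \<beta> * g \<gamma>)"
proof -
  have b': "bij (inv \<pi>)" using b bij_imp_bij_inv by blast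
  let ?m = "Poly_Mapping.map_key \<pi>" and ?m' = "Poly_Mapping.map_key (inv \<pi>)"
  show ?thesis
    by (rule sum.reindex_bij_witness[of _ "\<lambda>(x, y). (?m x, ?m y)" "\<lambda>(x, y). (?m' x, ?m' y)"])
      (auto simp: splits_def map_key_inverse[OF b] f g b b'
          map_key_plus[OF bij_is_inj[OF b], symmetric]
          map_key_plus[OF bij_is_inj[OF b'], symmetric])
qed

instantiation symf :: "{zero, one, plus, minus, uminus, times}"
begin

lift_definition zero_symf :: symf is "\<lambda>_. 0" by simp

lift_definition one_symf :: symf is "\<lambda>\<alpha>. if \<alpha> = 0 then 1 else 0"
  by (simp add: map_key_eq_0_iff)

lift_definition plus_symf :: "symf \<Rightarrow> symf \<Rightarrow> symf" is "\<lambda>f g \<alpha>. f \<alpha> + g \<alpha>" by simp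

lift_definition minus_symf :: "symf \<Rightarrow> symf \<Rightarrow> symf" is "\<lambda>f g \<alpha>. f \<alpha> - g \<alpha>" by simp

lift_definition uminus_symf :: "symf \<Rightarrow> symf" is "\<lambda>f \<alpha>. - f \<alpha>" by simp

lift_definition times_symf :: "symf \<Rightarrow> symf \<Rightarrow> symf"
  is "\<lambda>f g \<alpha>. \<Sum>(\<beta>, \<gamma>)\<in>splits \<alpha>. f \<beta> * g \<gamma>"
  by (rule sum_splits_map_key) auto

instance ..

end

lemma scoeff_mult: "scoeff (f * g) \<alpha> = (\<Sum>(\<beta>, \<gamma>)\<in>splits \<alpha>. scoeff f \<beta> * scoeff g \<gamma>)"
  by transfer simp

lemma scoeff_mult_assoc_left:
  "scoeff (f * g * h) \<alpha> =
    (\<Sum>(\<beta>, \<gamma>, \<delta>)\<in>{(\<beta>, \<gamma>, \<delta>). \<beta> + \<gamma> + \<delta> = \<alpha>}. scoeff f \<beta> * scoeff g \<gamma> * scoeff h \<delta>)"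
proof -
  have "scoeff (f * g * h) \<alpha> = (\<Sum>p\<in>splits \<alpha>. \<Sum>q\<in>splits (fst p).
      scoeff f (fst q) * scoeff g (snd q) * scoeff h (snd p))"
    by (simp add: scoeff_mult sum_distrib_right case_prod_unfold)
  also have "\<dots> = (\<Sum>(p, q)\<in>Sigma (splits \<alpha>) (\<lambda>p. splits (fst p)).
      scoeff f (fst q) * scoeff g (snd q) * scoeff h (snd p))"
    by (rule sum.Sigma) (auto simp: finite_splits)
  also have "\<dots> = (\<Sum>(\<beta>, \<gamma>, \<delta>)\<in>{(\<beta>, \<gamma>, \<delta>). \<beta> + \<gamma> + \<delta> = \<alpha>}. scoeff f \<beta> * scoeff g \<gamma> * scoeff h \<delta>)"
    by (rule sum.reindex_bij_witness[of _ "\<lambda>(\<beta>, \<gamma>, \<delta>). ((\<beta> + \<gamma>, \<delta>), (\<beta>, \<gamma>))"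
          "\<lambda>(p, q). (fst q, snd q, snd p)"]) (auto simp: splits_def)
  finally show ?thesis .
qed

lemma symf_mult_commute: "f * g = g * (f :: symf)"
proof (rule symf_eqI)
  fix \<alpha>
  show "scoeff (f * g) \<alpha> = scoeff (g * f) \<alpha>"
    unfolding scoeff_mult
    by (rule sum.reindex_bij_witness[of _ "\<lambda>(x, y). (y, x)" "\<lambda>(x, y). (y, x)"])
      (auto simp: splits_def add.commute)
qed

lemma symf_mult_assoc: "f * g * h = f * (g * (h :: symf))"
proof (rule symf_eqI)
  fix \<alpha>
  have "scoeff (f * (g * h)) \<alpha> = scoeff (g * h * f) \<alpha>"
    by (simp add: symf_mult_commute)
  also have "\<dots> = scoeff (f * g * h) \<alpha>"
    unfolding scoeff_mult_assoc_left
    by (rule sum.reindex_bij_witness[of _ "\<lambda>(\<beta>, \<gamma>, \<delta>). (\<gamma>, \<delta>, \<beta>)" "\<lambda>(\<beta>, \<gamma>, \<delta>). (\<delta>, \<beta>, \<gamma>)"])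
      (auto simp: ac_simps)
  finally show "scoeff (f * g * h) \<alpha> = scoeff (f * (g * h)) \<alpha>" by simp
qed

lemma symf_mult_1: "1 * f = (f :: symf)"
proof (rule symf_eqI)
  fix \<alpha>
  have "scoeff (1 * f) \<alpha> = (\<Sum>p\<in>splits \<alpha>. if p = (0, \<alpha>) then scoeff f \<alpha> else 0)"
    unfolding scoeff_mult
    by (rule sum.cong) (auto simp: splits_def one_symf.rep_eq split: if_splits)
  also have "\<dots> = scoeff f \<alpha>"
    by (simp add: finite_splits) (simp add: splits_def)
  finally show "scoeff (1 * f) \<alpha> = scoeff f \<alpha>" .
qed

instance symf :: comm_ring_1
proof
  fix a b c :: symf
  show "a * b * c = a * (b * c)" by (rule symf_mult_assoc)
  show "a * b = b * a" by (rule symf_mult_commute)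
  show "1 * a = a" by (rule symf_mult_1)
  show "a + b + c = a + (b + c)" by transfer (simp add: add.assoc)
  show "a + b = b + a" by transfer (simp add: add.commute)
  show "0 + a = a" by transfer simp
  show "- a + a = 0" by transfer simp
  show "a - b = a + - b" by transfer simp
  show "(a + b) * c = a * c + b * c"
    by transfer (simp add: distrib_right sum.distrib case_prod_unfold)
  show "(0 :: symf) \<noteq> 1" by transfer (metis zero_neq_one)
qed

text \<open>
  With this instance the library's \<open>inverse\<close> and \<open>/\<close> on \<^typ>\<open>symf fps\<close> are the inverse and
  division in the power series ring whenever the constant coefficient of the divisor is a unit.
\<close>

instantiation symf :: inverse
begin

definition inverse_symf :: "symf \<Rightarrow> symf"
  where "inverse (f :: symf) = (if \<exists>g. f * g = 1 then THE g. f * g = 1 else 0)"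

definition divide_symf :: "symf \<Rightarrow> symf \<Rightarrow> symf"
  where "(f :: symf) div g = f * inverse g"

instance ..

end

lemma symf_mult_inverse:
  fixes f g :: symf
  assumes "f * g = 1"
  shows "f * inverse f = 1"
proof -
  have "\<exists>!g. f * g = 1"
  proof (rule ex1I[of _ g])
    fix h assume "f * h = 1"
    then show "h = g" using assms by (metis mult.assoc mult.commute mult.left_neutral)
  qed (rule assms)
  then have "f * (THE g. f * g = 1) = 1" by (rule theI')
  then show ?thesis using assms by (auto simp: inverse_symf_def)
qed

lemma symf_fps_divide_eq:
  fixes F :: "symf fps"
  assumes "F $ 0 * g = 1"
  shows "1 / F * F = 1"
proof -
  have nz: "F $ 0 \<noteq> 0" using assms by auto
  have "F * inverse F = 1"
    unfolding fps_inverse_def using symf_mult_inverse[OF assms] by (rule fps_right_inverse)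
  moreover have "1 / F = inverse F"
    using nz by (simp add: fps_divide_def)
  ultimately show ?thesis by (simp add: mult.commute)
qed

subsection \<open>Monomial symmetric functions and power sums\<close>

text \<open>Partitions are weakly decreasing lists of positive integers; \<open>[]\<close> is the empty one.\<close>

definition is_partition :: "nat list \<Rightarrow> bool"
  where "is_partition \<mu> \<longleftrightarrow> sorted_wrt (\<ge>) \<mu> \<and> (\<forall>k\<in>set \<mu>. 0 < k)"

definition part_fact :: "nat list \<Rightarrow> rat"
  where "part_fact \<mu> = prod_list (map fact \<mu>)"

lemma exponents_map_key:
  fixes \<pi> :: "nat \<Rightarrow> nat" and \<alpha> :: expo
  assumes b: "bij \<pi>"
  shows "image_mset (Poly_Mapping.lookup (Poly_Mapping.map_key \<pi> \<alpha>))
      (mset_set (Poly_Mapping.keys (Poly_Mapping.map_key \<pi> \<alpha>))) =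
    image_mset (Poly_Mapping.lookup \<alpha>) (mset_set (Poly_Mapping.keys \<alpha>))"
proof -
  have i: "inj \<pi>" and s: "surj \<pi>" using b by (auto simp: bij_def)
  have "Poly_Mapping.lookup (Poly_Mapping.map_key \<pi> \<alpha>) = Poly_Mapping.lookup \<alpha> \<circ> \<pi>"
    using i by (simp add: map_key.rep_eq)
  moreover have "image_mset \<pi> (mset_set (\<pi> -` Poly_Mapping.keys \<alpha>)) = mset_set (Poly_Mapping.keys \<alpha>)"
    using i s by (simp add: image_mset_mset_set inj_on_subset surj_image_vimage_eq)
  ultimately show ?thesis
    using i by (metis keys_map_key multiset.map_comp)
qed

text \<open>
  The monomial symmetric function is the sum of all distinct monomials whose nonzero exponents
  are the parts of \<open>\<mu>\<close> in some order.
\<close>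

lift_definition mono_sym :: "nat list \<Rightarrow> symf"
  is "\<lambda>\<mu> \<alpha>. if image_mset (Poly_Mapping.lookup \<alpha>) (mset_set (Poly_Mapping.keys \<alpha>)) = mset \<mu>
    then 1 else 0"
  by (simp add: exponents_map_key)

lemma single_map_key_iff:
  fixes \<pi> :: "nat \<Rightarrow> nat" and \<alpha> :: expo
  assumes b: "bij \<pi>"
  shows "(\<exists>i. Poly_Mapping.map_key \<pi> \<alpha> = Poly_Mapping.single i n) \<longleftrightarrow>
    (\<exists>i. \<alpha> = Poly_Mapping.single i n)"
proof -
  have *: "\<exists>i. Poly_Mapping.map_key \<rho> \<beta> = Poly_Mapping.single i n"
    if "bij \<rho>" "\<beta> = Poly_Mapping.single j n" for \<rho> :: "nat \<Rightarrow> nat" and \<beta> j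
    using map_key_single[of \<rho> "inv \<rho> j" n] that bij_is_inj[of \<rho>] bij_is_surj[of \<rho>]
    by (auto simp: surj_f_inv_f)
  show ?thesis
    using *[OF b] *[OF bij_imp_bij_inv[OF b], of "Poly_Mapping.map_key \<pi> \<alpha>"]
    by (metis b map_key_inverse(2))
qed

text \<open>\<open>power_sum n\<close> is \<open>\<Sum>\<^sub>i x\<^sub>i ^ n\<close>, for \<open>n \<ge> 1\<close>.\<close>

lift_definition power_sum :: "nat \<Rightarrow> symf"
  is "\<lambda>n \<alpha>. if \<exists>i. \<alpha> = Poly_Mapping.single i n then 1 else 0"
  by (simp add: single_map_key_iff)

subsection \<open>Formal infinite sums and the logarithm\<close>

lift_definition symf_const :: "rat \<Rightarrow> symf" is "\<lambda>c \<alpha>. if \<alpha> = 0 then c else 0"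
  by (simp add: map_key_eq_0_iff)

definition scaleQ :: "rat \<Rightarrow> symf fps \<Rightarrow> symf fps"  (infixr \<open>*\<^sub>Q\<close> 75)
  where "c *\<^sub>Q F = fps_const (symf_const c) * F"

lift_definition symf_sum :: "('i \<Rightarrow> symf) \<Rightarrow> 'i set \<Rightarrow> symf"
  is "\<lambda>f A \<alpha>. \<Sum>i\<in>{i \<in> A. f i \<alpha> \<noteq> 0}. f i \<alpha>"
  by simp

text \<open>
  An infinite sum is formed coefficient by coefficient; it makes sense if every coefficient, with
  respect to both the power series variable and the variables of the symmetric functions,
  is nonzero for only finitely many summands.
\<close>

definition formally_summable :: "('i \<Rightarrow> symf fps) \<Rightarrow> 'i set \<Rightarrow> bool"
  where "formally_summable F A \<longleftrightarrow> (\<forall>n \<alpha>. finite {i \<in> A. scoeff (F i $ n) \<alpha> \<noteq> 0})"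

definition formal_sum :: "('i \<Rightarrow> symf fps) \<Rightarrow> 'i set \<Rightarrow> symf fps"
  where "formal_sum F A = Abs_fps (\<lambda>n. symf_sum (\<lambda>i. F i $ n) A)"

text \<open>The usual series; the sum makes sense if \<open>F\<close> has constant term 1 in all variables.\<close>

definition formal_ln :: "symf fps \<Rightarrow> symf fps"
  where "formal_ln F = formal_sum (\<lambda>k. ((- 1) ^ (k - 1) / of_nat k) *\<^sub>Q (F - 1) ^ k) {1..}"

text \<open>The terms \<open>z\<^sup>n/n! m\<^sub>\<mu>/\<mu>!\<close>.\<close>

definition mono_term :: "nat \<Rightarrow> nat list \<Rightarrow> symf fps"
  where "mono_term n \<mu> = (1 / (fact n * part_fact \<mu>)) *\<^sub>Q (fps_X ^ n * fps_const (mono_sym \<mu>))"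

text \<open>\<open>\<Sum>\<^bsub>n \<ge> 1\<^esub> (-1)\<^bsup>n-1\<^esup> p\<^sub>n\<close> as a constant power series.\<close>

definition alt_power_sums :: "symf fps"
  where "alt_power_sums = formal_sum (\<lambda>n. (- 1) ^ (n - 1) *\<^sub>Q fps_const (power_sum n)) {1..}"

subsection \<open>These sums, inverses and logarithms make sense\<close>

definition tdeg :: "expo \<Rightarrow> nat"
  where "tdeg \<alpha> = (\<Sum>i\<in>Poly_Mapping.keys \<alpha>. Poly_Mapping.lookup \<alpha> i)"

lemma tdeg_superset:
  "finite K \<Longrightarrow> Poly_Mapping.keys \<alpha> \<subseteq> K \<Longrightarrow> tdeg \<alpha> = (\<Sum>i\<in>K. Poly_Mapping.lookup \<alpha> i)"
  unfolding tdeg_def by (rule sum.mono_neutral_left) (auto simp: in_keys_iff)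

lemma tdeg_add: "tdeg (\<alpha> + \<beta>) = tdeg \<alpha> + tdeg \<beta>"
proof -
  let ?K = "Poly_Mapping.keys \<alpha> \<union> Poly_Mapping.keys \<beta>"
  have "finite ?K" "Poly_Mapping.keys (\<alpha> + \<beta>) \<subseteq> ?K"
    using Poly_Mapping.keys_add[of \<alpha> \<beta>] by auto
  then show ?thesis
    by (simp add: tdeg_superset[of ?K] lookup_add sum.distrib)
qed

lemma tdeg_eq_0_iff: "tdeg \<alpha> = 0 \<longleftrightarrow> \<alpha> = 0"
  by (simp add: tdeg_def in_keys_iff poly_mapping_eq_iff fun_eq_iff)

lemma scoeff_sum: "scoeff (sum f A) \<alpha> = (\<Sum>i\<in>A. scoeff (f i) \<alpha>)"
  by (induction A rule: infinite_finite_induct) (simp_all add: zero_symf.rep_eq plus_symf.rep_eq)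

lemma scoeff_power_eq_0:
  assumes "scoeff w 0 = 0" and "tdeg \<alpha> < k"
  shows "scoeff (w ^ k) \<alpha> = 0"
  using assms(2)
proof (induction k arbitrary: \<alpha>)
  case (Suc k)
  have eq: "scoeff w \<beta> * scoeff (w ^ k) \<gamma> = 0" if "(\<beta>, \<gamma>) \<in> splits \<alpha>" for \<beta> \<gamma>
  proof (cases "\<beta> = 0")
    case False
    then have "tdeg \<beta> > 0" by (metis tdeg_eq_0_iff gr0I)
    then have "tdeg \<gamma> < k" using that Suc.prems unfolding splits_def by (clarsimp simp: tdeg_add)
    then show ?thesis using Suc.IH by simp
  qed (simp add: assms(1))
  show ?case
    unfolding power_Suc scoeff_mult by (rule sum.neutral) (use eq in auto)
qed simp

lemma symf_unit:
  assumes "scoeff f 0 = 1"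
  shows "\<exists>g. f * g = 1"
proof -
  define w where "w = 1 - f"
  have w0: "scoeff w 0 = 0"
    using assms by (simp add: w_def minus_symf.rep_eq one_symf.rep_eq)
  define g where "g = symf_sum (\<lambda>k. w ^ k) UNIV"
  have g: "scoeff g \<beta> = scoeff (\<Sum>k<N. w ^ k) \<beta>" if "tdeg \<beta> < N" for \<beta> N
  proof -
    have "{k. scoeff (w ^ k) \<beta> \<noteq> 0} \<subseteq> {..<N}"
    proof
      fix k assume k: "k \<in> {k. scoeff (w ^ k) \<beta> \<noteq> 0}"
      have "\<not> tdeg \<beta> < k"
      proof
        assume "tdeg \<beta> < k"
        from scoeff_power_eq_0[OF w0 this] k show False by simp
      qed
      then show "k \<in> {..<N}" using that by simp
    qed
    then have "(\<Sum>k\<in>{k. scoeff (w ^ k) \<beta> \<noteq> 0}. scoeff (w ^ k) \<beta>) = (\<Sum>k<N. scoeff (w ^ k) \<beta>)"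
      by (intro sum.mono_neutral_left) auto
    then show ?thesis by (simp add: g_def symf_sum.rep_eq scoeff_sum)
  qed
  have "scoeff (f * g) \<alpha> = scoeff 1 \<alpha>" for \<alpha>
  proof -
    let ?N = "Suc (tdeg \<alpha>)"
    have "scoeff (f * g) \<alpha> = scoeff (f * (\<Sum>k<?N. w ^ k)) \<alpha>"
      unfolding scoeff_mult
    proof (rule sum.cong[OF refl], clarify)
      fix \<beta> \<gamma> assume "(\<beta>, \<gamma>) \<in> splits \<alpha>"
      then have "tdeg \<gamma> < ?N" by (auto simp: splits_def tdeg_add)
      then show "scoeff f \<beta> * scoeff g \<gamma> = scoeff f \<beta> * scoeff (\<Sum>k<?N. w ^ k) \<gamma>"
        by (simp only: g)
    qed
    also have "f * (\<Sum>k<?N. w ^ k) = 1 - w ^ ?N"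
      using one_diff_power_eq[of w ?N] by (simp add: w_def)
    also have "scoeff \<dots> \<alpha> = scoeff 1 \<alpha>"
      using scoeff_power_eq_0[OF w0, of \<alpha> ?N] by (simp add: minus_symf.rep_eq)
    finally show ?thesis .
  qed
  then show ?thesis using symf_eqI by blast
qed

lemma fps_divide_makes_sense:
  assumes "scoeff (F $ 0) 0 = 1"
  shows "1 / F * F = 1"
  using symf_unit[OF assms] symf_fps_divide_eq by blast

lemma scoeff_fps_power_eq_0:
  assumes "scoeff (W $ 0) 0 = 0" and "n + tdeg \<alpha> < k"
  shows "scoeff ((W ^ k) $ n) \<alpha> = 0"
  using assms(2)
proof (induction k arbitrary: n \<alpha>)
  case (Suc k)
  have eq: "scoeff (W $ i) \<beta> * scoeff ((W ^ k) $ (n - i)) \<gamma> = 0"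
    if "i \<le> n" "(\<beta>, \<gamma>) \<in> splits \<alpha>" for i \<beta> \<gamma>
  proof (cases "i = 0 \<and> \<beta> = 0")
    case False
    then have "i + tdeg \<beta> > 0" by (metis tdeg_eq_0_iff gr0I add_is_0)
    then have "(n - i) + tdeg \<gamma> < k" using that Suc.prems unfolding splits_def by (clarsimp simp: tdeg_add) linarith
    then show ?thesis using Suc.IH by simp
  qed (simp add: assms(1))
  show ?case
    unfolding power_Suc fps_mult_nth scoeff_sum scoeff_mult
  proof (intro sum.neutral ballI)
    fix i p assume "i \<in> {0..n}" "p \<in> splits \<alpha>"
    then show "(case p of (\<beta>, \<gamma>) \<Rightarrow> scoeff (W $ i) \<beta> * scoeff ((W ^ k) $ (n - i)) \<gamma>) = 0"
      using eq by (cases p) auto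
  qed
qed simp

lemma scoeff_const_mult: "scoeff (symf_const c * f) \<alpha> = c * scoeff f \<alpha>"
proof -
  have "scoeff (symf_const c * f) \<alpha> = (\<Sum>p\<in>splits \<alpha>. if p = (0, \<alpha>) then c * scoeff f \<alpha> else 0)"
    unfolding scoeff_mult
    by (rule sum.cong) (auto simp: splits_def symf_const.rep_eq split: if_splits)
  also have "\<dots> = c * scoeff f \<alpha>"
    by (simp add: finite_splits) (simp add: splits_def)
  finally show ?thesis .
qed

lemma scoeff_scaleQ: "scoeff ((c *\<^sub>Q F) $ n) \<alpha> = c * scoeff (F $ n) \<alpha>"
  by (simp add: scaleQ_def scoeff_const_mult)

lemma formal_ln_summable:
  assumes "scoeff (F $ 0) 0 = 1"
  shows "formally_summable (\<lambda>k. ((- 1) ^ (k - 1) / of_nat k) *\<^sub>Q (F - 1) ^ k) {1..}"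
  unfolding formally_summable_def
proof (intro allI)
  fix n \<alpha>
  have 0: "scoeff ((F - 1) $ 0) 0 = 0"
    using assms by (simp add: minus_symf.rep_eq one_symf.rep_eq)
  have "{k \<in> {1..}. scoeff ((((- 1) ^ (k - 1) / of_nat k) *\<^sub>Q (F - 1) ^ k) $ n) \<alpha> \<noteq> 0} \<subseteq> {..n + tdeg \<alpha>}"
    using scoeff_fps_power_eq_0[OF 0, of n \<alpha>] by (auto simp: scoeff_scaleQ simp flip: not_less)
  then show "finite {k \<in> {1..}. scoeff ((((- 1) ^ (k - 1) / of_nat k) *\<^sub>Q (F - 1) ^ k) $ n) \<alpha> \<noteq> 0}"
    by (rule finite_subset) simp
qed

lemma power_sums_summable: "formally_summable (\<lambda>n. c n *\<^sub>Q fps_const (power_sum n)) {1..}"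
  unfolding formally_summable_def
proof (intro allI)
  fix m \<alpha>
  have "k \<le> tdeg \<alpha>" if "scoeff ((c k *\<^sub>Q fps_const (power_sum k)) $ m) \<alpha> \<noteq> 0" for k
  proof -
    have "scoeff (power_sum k) \<alpha> \<noteq> 0"
      using that by (auto simp: scoeff_scaleQ zero_symf.rep_eq split: if_splits)
    then obtain i where "\<alpha> = Poly_Mapping.single i k"
      by (auto simp: power_sum.rep_eq split: if_splits)
    then show ?thesis by (simp add: tdeg_def)
  qed
  then have "{k \<in> {1..}. scoeff ((c k *\<^sub>Q fps_const (power_sum k)) $ m) \<alpha> \<noteq> 0} \<subseteq> {..tdeg \<alpha>}"
    by auto
  then show "finite {k \<in> {1..}. scoeff ((c k *\<^sub>Q fps_const (power_sum k)) $ m) \<alpha> \<noteq> 0}"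
    by (rule finite_subset) simp
qed

lemma scoeff_alt_power_sums_0: "scoeff (alt_power_sums $ 0) 0 = 0"
proof -
  have p: "scoeff (power_sum k) 0 = 0" if "k \<ge> 1" for k
  proof -
    have "(0 :: expo) \<noteq> Poly_Mapping.single i k" for i
      using that by (metis lookup_single_eq lookup_zero not_one_le_zero)
    then show ?thesis by (simp add: power_sum.rep_eq)
  qed
  show ?thesis
    unfolding alt_power_sums_def formal_sum_def
    by (simp add: symf_sum.rep_eq scoeff_scaleQ p sum.neutral)
qed

lemma scoeff_one_minus: "scoeff ((1 - (fps_X + alt_power_sums)) $ 0) 0 = 1"
  by (simp add: minus_symf.rep_eq one_symf.rep_eq scoeff_alt_power_sums_0)

section \<open>Hamiltonian paths and cycles\<close>

record 'a graph =
  verts :: "'a set"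
  adj :: "'a \<Rightarrow> 'a \<Rightarrow> bool"

text \<open>The vertex \<open>(i, j)\<close> is the \<open>j\<close>-th vertex of the \<open>i\<close>-th block.\<close>

definition complete_multipartite :: "nat list \<Rightarrow> (nat \<times> nat) graph"
  where "complete_multipartite \<mu> =
    \<lparr>verts = {(i, j). i < length \<mu> \<and> j < \<mu> ! i}, adj = (\<lambda>u v. fst u \<noteq> fst v)\<rparr>"

definition ham_paths :: "'a graph \<Rightarrow> 'a list set"
  where "ham_paths G = {vs. distinct vs \<and> set vs = verts G \<and> successively (adj G) vs}"

definition HP :: "'a graph \<Rightarrow> nat"
  where "HP G = card (ham_paths G)"

text \<open>
  Directed Hamiltonian cycles are counted as classes of orderings up to rotation. The connected
  graph on two vertices has exactly one such class, as the usual convention demands.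
\<close>

definition closed_ham_paths :: "'a graph \<Rightarrow> 'a list set"
  where "closed_ham_paths G = {vs \<in> ham_paths G. vs \<noteq> [] \<and> adj G (last vs) (hd vs)}"

definition rotation_class :: "'a list \<Rightarrow> 'a list set"
  where "rotation_class vs = range (\<lambda>k. rotate k vs)"

definition HC :: "'a graph \<Rightarrow> nat"
  where "HC G = card (rotation_class ` closed_ham_paths G)"

end

(* The coefficient of z^n x^alpha on the left-hand side counts, after division by the
   factorials, the words with n letters z and alpha_i letters x_i in which no two adjacent letters
   (cyclically adjacent, for cycles) are the same x_i. By inclusion-exclusion this is the
   signed sum over words with some equal adjacent letters joined; a linear word with k blocks
   of joined letters has sign (-1)^(N-k), N being the length, and such objects are counted up to
   sign by the coefficient of (z + p_1 - p_2 + ...)^k. Summing over k gives the geometric series.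
   For cyclic words, let C_k be the number of cyclically joined words with k >= 1 blocks and L_k
   the number of linear ones: counting pairs of a joined word and the end of a block, and
   rotating this end to the last position, gives k C_k = N L_k. Hence dividing by N (cycles are
   taken up to rotation) turns the geometric series into the logarithm. The words with all
   positions cyclically joined, k = 0, are constant and give the sum of the (-1)^n p_n / n. *)

theory Submission
  imports Defs "HOL-Library.Product_Plus"
begin

section \<open>Preliminaries: alternating sums, lists of given total weight, cyclic
  adjacency\<close>

section \<open>Words and marked words\<close>

text \<open>The subsets containing the new element \<open>a\<close> cancel those without it; this is
  the cancellation behind inclusion-exclusion.\<close>

lemma sum_Pow_minus_one_power_card:
  assumes "finite A"
  shows "(\<Sum>S\<in>Pow A. (- 1) ^ card S) = (if A = {} then 1 else 0 :: rat)"
  using assms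
proof (induction A rule: finite_induct)
  case (insert a A)
  have "inj_on (insert a) (Pow A)"
    using insert.hyps(2) by (auto simp: inj_on_def)
  moreover have "card (insert a S) = Suc (card S)" if "S \<in> Pow A" for S
    using that insert.hyps by (meson Pow_iff card_insert_disjoint finite_subset subsetD)
  ultimately have "(\<Sum>S\<in>insert a ` Pow A. (- 1) ^ card S) = - (\<Sum>S\<in>Pow A. (- 1) ^ card S :: rat)"
    by (simp add: sum.reindex sum_negf)
  moreover have "Pow A \<inter> insert a ` Pow A = {}" using insert.hyps(2) by auto
  ultimately show ?case
    using insert.hyps by (simp add: Pow_insert sum.union_disjoint)
qed simp

text \<open>Lets the variables of a monomial be listed so that their exponents read as a given
  partition.\<close>

lemma image_mset_eq_mset_imp:
  assumes "image_mset f M = mset xs"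
  shows "\<exists>ys. mset ys = M \<and> map f ys = xs"
  using assms
proof (induction xs arbitrary: M)
  case (Cons x xs)
  then have M: "image_mset f M = add_mset x (mset xs)"
    by (simp only: mset.simps)
  obtain N y where N: "M = add_mset y N" "f y = x" "image_mset f N = mset xs"
    using msed_map_invR[OF M] by blast
  obtain ys where "mset ys = N" "map f ys = xs"
    using Cons.IH[OF N(3)] by blast
  then have "mset (y # ys) = M \<and> map f (y # ys) = x # xs"
    using N(1,2) by (simp only: mset.simps list.map)
  then show ?case by (rule exI)
next
  case Nil
  then have "mset [] = M \<and> map f [] = []" by simp
  then show ?case by (rule exI)
qed

text \<open>With \<open>blocks\<close> and \<open>block_content\<close> these are the linear joined
  words cut into their \<open>k\<close> blocks.\<close>

definition weighted_lists :: "'b set \<Rightarrow> ('b \<Rightarrow> 'm::comm_monoid_add) \<Rightarrow> nat \<Rightarrow> 'm \<Rightarrow> 'b list set"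
  where "weighted_lists B \<kappa> k c = {bs. length bs = k \<and> set bs \<subseteq> B \<and> sum_list (map \<kappa> bs) = c}"

lemma weighted_lists_0: "weighted_lists B \<kappa> 0 c = (if c = 0 then {[]} else {})"
  by (auto simp: weighted_lists_def)

text \<open>Splitting off the first entry and recording the weights of both pieces gives the shape
  of a Cauchy product.\<close>

lemma weighted_lists_Suc:
  "bij_betw (\<lambda>(_, b, bs). b # bs)
    (SIGMA p : {(x, y). x + y = c}. {b \<in> B. \<kappa> b = fst p} \<times> weighted_lists B \<kappa> k (snd p))
    (weighted_lists B \<kappa> (Suc k) c)"
  by (rule bij_betw_byWitness[where f' = "\<lambda>bs. ((\<kappa> (hd bs), sum_list (map \<kappa> (tl bs))), hd bs, tl bs)"])
    (auto simp: weighted_lists_def length_Suc_conv)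

lemma card_weighted_lists_Suc:
  assumes "finite {(x, y). x + y = c}"
    and "\<And>x. finite {b \<in> B. \<kappa> b = x}" and "\<And>x. finite (weighted_lists B \<kappa> k x)"
  shows "finite (weighted_lists B \<kappa> (Suc k) c)"
    and "card (weighted_lists B \<kappa> (Suc k) c) =
      (\<Sum>(x, y)\<in>{(x, y). x + y = c}. card {b \<in> B. \<kappa> b = x} * card (weighted_lists B \<kappa> k y))"
proof -
  let ?S = "SIGMA p : {(x, y). x + y = c}. {b \<in> B. \<kappa> b = fst p} \<times> weighted_lists B \<kappa> k (snd p)"
  have "finite ?S"
    using assms by (intro finite_SigmaI finite_cartesian_product) auto
  then show "finite (weighted_lists B \<kappa> (Suc k) c)"
    using bij_betw_finite[OF weighted_lists_Suc, of c B \<kappa> k] by blast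
  have "card (weighted_lists B \<kappa> (Suc k) c) = card ?S"
    using bij_betw_same_card[OF weighted_lists_Suc, of c B \<kappa> k] by simp
  also have "\<dots> = (\<Sum>p\<in>{(x, y). x + y = c}. card ({b \<in> B. \<kappa> b = fst p} \<times> weighted_lists B \<kappa> k (snd p)))"
    using assms by (intro card_SigmaI) auto
  finally show "card (weighted_lists B \<kappa> (Suc k) c) =
      (\<Sum>(x, y)\<in>{(x, y). x + y = c}. card {b \<in> B. \<kappa> b = x} * card (weighted_lists B \<kappa> k y))"
    by (simp add: card_cartesian_product case_prod_unfold)
qed

text \<open>The successor index is taken modulo the length, so a list with one entry compares that
  entry with itself.\<close>

definition cyclically :: "('a \<Rightarrow> 'a \<Rightarrow> bool) \<Rightarrow> 'a list \<Rightarrow> bool"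
  where "cyclically R xs \<longleftrightarrow> (\<forall>i<length xs. R (xs ! i) (xs ! (Suc i mod length xs)))"

text \<open>Rotation shifts both indices of a cyclically adjacent pair by \<open>k\<close> modulo
  the length.\<close>

lemma cyclically_rotate:
  assumes "cyclically R xs" shows "cyclically R (rotate k xs)"
  unfolding cyclically_def
proof (intro allI impI)
  fix i assume i: "i < length (rotate k xs)"
  let ?N = "length xs"
  have N: "?N > 0" using i by (metis length_rotate less_nat_zero_code neq0_conv)
  have "Suc i mod ?N < ?N" using N by simp
  then have "rotate k xs ! (Suc i mod ?N) = xs ! (Suc ((k + i) mod ?N) mod ?N)"
    by (simp add: nth_rotate mod_simps)
  moreover have "rotate k xs ! i = xs ! ((k + i) mod ?N)" using i by (simp add: nth_rotate)
  moreover have "(k + i) mod ?N < ?N" using N by simp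
  ultimately show "R (rotate k xs ! i) (rotate k xs ! (Suc i mod length (rotate k xs)))"
    using assms unfolding cyclically_def by (metis length_rotate)
qed

lemma cyclically_iff:
  assumes "xs \<noteq> []"
  shows "cyclically R xs \<longleftrightarrow> successively R xs \<and> R (last xs) (hd xs)"
proof -
  obtain N where N: "length xs = Suc N" using assms by (cases xs) auto
  have "cyclically R xs \<longleftrightarrow> (\<forall>i<N. R (xs ! i) (xs ! (Suc i mod Suc N))) \<and> R (xs ! N) (xs ! 0)"
    unfolding cyclically_def N All_less_Suc by auto
  also have "(\<forall>i<N. R (xs ! i) (xs ! (Suc i mod Suc N))) \<longleftrightarrow> successively R xs"
    by (simp add: successively_conv_nth N)
  also have "R (xs ! N) (xs ! 0) \<longleftrightarrow> R (last xs) (hd xs)"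
    using assms N by (simp add: last_conv_nth hd_conv_nth)
  finally show ?thesis .
qed

section \<open>Words in z and the x_i, and their content\<close>

text \<open>The letter \<open>None\<close> stands for the variable \<open>z\<close>, the letter \<open>Some i\<close> for \<open>x\<^sub>i\<close>.\<close>

type_synonym letter = "nat option"

text \<open>Copies of z may stand side by side: they represent different blocks of size 1 of the
  graph, whereas copies of one x_i represent vertices of the same block.\<close>

definition compatible :: "letter \<Rightarrow> letter \<Rightarrow> bool"
  where "compatible a b \<longleftrightarrow> a \<noteq> b \<or> a = None"

definition letter_content :: "letter \<Rightarrow> nat \<times> expo"
  where "letter_content a = (case a of None \<Rightarrow> (1, 0) | Some i \<Rightarrow> (0, Poly_Mapping.single i 1))"

definition content :: "letter list \<Rightarrow> nat \<times> expo"
  where "content w = sum_list (map letter_content w)"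

text \<open>The degree of the monomial, with z of degree 1; it is the length of every word with this
  content.\<close>

definition weight :: "nat \<times> expo \<Rightarrow> nat"
  where "weight c = fst c + tdeg (snd c)"

lemma content_simps [simp]: "content [] = 0" "content (a # w) = letter_content a + content w"
  by (simp_all add: content_def)

lemma content_append [simp]: "content (v @ w) = content v + content w"
  by (simp add: content_def)

lemma tdeg_single [simp]: "tdeg (Poly_Mapping.single i m) = m"
  by (cases "m = 0") (simp_all add: tdeg_def)

lemma tdeg_0 [simp]: "tdeg 0 = 0"
  by (simp add: tdeg_eq_0_iff)

lemma weight_simps [simp]: "weight (a + b) = weight a + weight b" "weight 0 = 0"
  "weight (n, \<alpha>) = n + tdeg \<alpha>"
  by (simp_all add: weight_def tdeg_add)

lemma weight_letter_content [simp]: "weight (letter_content a) = 1"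
  by (cases a) (simp_all add: letter_content_def)

lemma length_eq_weight: "length w = weight (content w)"
  by (induction w) simp_all

lemma content_eq_iff:
  "content w = (n, \<alpha>) \<longleftrightarrow>
    count_list w None = n \<and> (\<forall>i. count_list w (Some i) = Poly_Mapping.lookup \<alpha> i)"
proof -
  have "fst (content w) = count_list w None"
    by (induction w) (auto simp: letter_content_def split: option.split)
  moreover have "Poly_Mapping.lookup (snd (content w)) i = count_list w (Some i)" for i
    by (induction w) (auto simp: letter_content_def lookup_add lookup_single split: option.split)
  ultimately show ?thesis
    by (auto simp: prod_eq_iff poly_mapping_eq_iff fun_eq_iff)
qed

lemma content_rotate: "content (rotate k w) = content w"
proof (induction k)
  case (Suc k)
  have "content (rotate1 v) = content v" for v
    by (cases v) (simp_all add: add.commute)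
  then show ?case using Suc by simp
qed simp

lemma count_list_rotate: "count_list (rotate k xs) x = count_list xs x"
proof (induction k)
  case (Suc k)
  have "count_list (rotate1 ys) x = count_list ys x" for ys
    by (cases ys) simp_all
  then show ?case using Suc by simp
qed simp

lemma finite_content: "finite {w. content w = c}"
proof -
  obtain n \<alpha> where c: "c = (n, \<alpha>)" by (cases c)
  let ?K = "insert None (Some ` Poly_Mapping.keys \<alpha>)"
  have "{w. content w = c} \<subseteq> {w. set w \<subseteq> ?K \<and> length w = weight c}"
  proof clarify
    fix w assume w: "c = content w"
    have "a \<in> ?K" if "a \<in> set w" for a
    proof (cases a)
      case (Some i)
      then have "Poly_Mapping.lookup \<alpha> i \<noteq> 0"
        using w c that content_eq_iff[of w n \<alpha>] by (metis count_list_0_iff)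
      then show ?thesis using Some by (simp add: in_keys_iff)
    qed simp
    then show "set w \<subseteq> ?K \<and> length w = weight (content w)"
      using length_eq_weight by blast
  qed
  then show ?thesis
    by (rule finite_subset) (intro finite_lists_length_eq; simp)
qed

section \<open>Joined words, cyclic and linear\<close>

text \<open>The mark at a position says that it is joined to the next one, cyclically, into the same block.\<close>

definition cyclic_marked :: "(letter \<times> bool) list \<Rightarrow> bool"
  where "cyclic_marked u \<longleftrightarrow> (\<forall>i<length u. snd (u ! i) \<longrightarrow>
    \<not> compatible (fst (u ! i)) (fst (u ! (Suc i mod length u))))"

text \<open>An unmarked position ends a block, so \<open>k\<close> is the number of blocks when
  positive, and the cardinality is then the C_k of the rotation argument; \<open>k = 0\<close> means
  that every position is joined to the next.\<close>

definition cmarked :: "nat \<times> expo \<Rightarrow> nat \<Rightarrow> (letter \<times> bool) list set"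
  where "cmarked c k = {u. content (map fst u) = c \<and> cyclic_marked u \<and> count_list (map snd u) False = k}"

text \<open>An unmarked last position cuts the cycle between the last and the first letter, which
  leaves the linear joined words counted by L_k.\<close>

definition lmarked :: "nat \<times> expo \<Rightarrow> nat \<Rightarrow> (letter \<times> bool) list set"
  where "lmarked c k = {u \<in> cmarked c k. u \<noteq> [] \<longrightarrow> \<not> snd (last u)}"

lemma finite_marked: "finite {u :: (letter \<times> bool) list. content (map fst u) = c}"
proof -
  have "{u :: (letter \<times> bool) list. content (map fst u) = c} \<subseteq>
    (\<lambda>(w, bs). zip w bs) ` ({w. content w = c} \<times> {bs. set bs \<subseteq> UNIV \<and> length bs = weight c})"
  proof
    fix u :: "(letter \<times> bool) list" assume "u \<in> {u. content (map fst u) = c}"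
    then have "(map fst u, map snd u) \<in>
      {w. content w = c} \<times> {bs. set bs \<subseteq> UNIV \<and> length bs = weight c}"
      using length_eq_weight[of "map fst u"] by simp
    moreover have "u = (\<lambda>(w, bs). zip w bs) (map fst u, map snd u)" by (simp add: zip_map_fst_snd)
    ultimately show "u \<in> (\<lambda>(w, bs). zip w bs) ` ({w. content w = c} \<times> {bs. set bs \<subseteq> UNIV \<and> length bs = weight c})"
      by blast
  qed
  then show ?thesis
    by (rule finite_subset) (intro finite_imageI finite_cartesian_product finite_content finite_lists_length_eq; simp)
qed

lemma finite_cmarked: "finite (cmarked c k)"
  by (rule finite_subset[OF _ finite_marked[of c]]) (auto simp: cmarked_def)

lemma cyclic_marked_rotate: "cyclic_marked u \<Longrightarrow> cyclic_marked (rotate k u)"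
  using cyclically_rotate[of "\<lambda>x y. snd x \<longrightarrow> \<not> compatible (fst x) (fst y)" u k]
  by (simp add: cyclic_marked_def cyclically_def)

lemma rotate_cmarked: "u \<in> cmarked c k \<Longrightarrow> rotate j u \<in> cmarked c k"
  by (simp add: cmarked_def cyclic_marked_rotate content_rotate count_list_rotate flip: rotate_map)

lemma card_positions_eq_count_list:
  "card {i. i < length bs \<and> bs ! i = x} = count_list bs x"
  by (simp add: count_list_eq_length_filter length_filter_conv_card eq_commute)

lemma card_filter_eq_sum:
  "finite A \<Longrightarrow> card {x \<in> A. P x} = (\<Sum>x\<in>A. if P x then 1 else 0)"
  by (simp flip: sum.inter_filter)

text \<open>
  Count the pairs of an element of \<open>cmarked c k\<close> and a position whose mark is not set: summing
  over the words first gives the left-hand side, and rotating the position to the end the right.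
\<close>

lemma card_cmarked_lmarked:
  "k * card (cmarked c k) = weight c * card (lmarked c k)"
proof (cases "weight c = 0")
  case True
  have "k = 0" if "u \<in> cmarked c k" for u
    using that True length_eq_weight[of "map fst u"] by (auto simp: cmarked_def)
  then have "k = 0 \<or> cmarked c k = {}" by blast
  then show ?thesis using True by auto
next
  case False
  let ?N = "weight c"
  have len: "length u = ?N" if "u \<in> cmarked c k" for u
    using that length_eq_weight[of "map fst u"] by (auto simp: cmarked_def)
  have "k * card (cmarked c k) = (\<Sum>u\<in>cmarked c k. card {i. i < ?N \<and> \<not> snd (u ! i)})"
  proof -
    have "card {i. i < ?N \<and> \<not> snd (u ! i)} = k" if "u \<in> cmarked c k" for u
    proof -
      have "{i. i < ?N \<and> \<not> snd (u ! i)} = {i. i < length (map snd u) \<and> map snd u ! i = False}"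
        using len[OF that] by auto
      then show ?thesis using that by (simp only: card_positions_eq_count_list) (simp add: cmarked_def)
    qed
    then show ?thesis by simp
  qed
  also have "\<dots> = (\<Sum>u\<in>cmarked c k. \<Sum>i<?N. if \<not> snd (u ! i) then 1 else 0)"
    by (intro sum.cong refl) (simp flip: card_filter_eq_sum)
  also have "\<dots> = (\<Sum>i<?N. \<Sum>u\<in>cmarked c k. if \<not> snd (u ! i) then 1 else 0)"
    by (rule sum.swap)
  also have "\<dots> = (\<Sum>i<?N. card {u \<in> cmarked c k. \<not> snd (u ! i)})"
    by (intro sum.cong refl) (simp add: card_filter_eq_sum finite_cmarked)
  also have "\<dots> = (\<Sum>i<?N. card (lmarked c k))"
  proof (intro sum.cong refl)
    fix i assume i: "i \<in> {..<?N}"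
    have last: "last v = v ! (?N - 1)" "v \<noteq> []" if "v \<in> cmarked c k" for v
      using len[OF that] False by (metis last_conv_nth list.size(3), auto)
    have "bij_betw (rotate (Suc i)) {u \<in> cmarked c k. \<not> snd (u ! i)} (lmarked c k)"
    proof (rule bij_betw_byWitness[where f' = "rotate (?N - Suc i)"])
      show "\<forall>u\<in>{u \<in> cmarked c k. \<not> snd (u ! i)}. rotate (?N - Suc i) (rotate (Suc i) u) = u"
        using i len by (simp add: rotate_rotate del: rotate_Suc)
      show "\<forall>u\<in>lmarked c k. rotate (Suc i) (rotate (?N - Suc i) u) = u"
        using i len by (simp add: lmarked_def rotate_rotate del: rotate_Suc)
      show "rotate (Suc i) ` {u \<in> cmarked c k. \<not> snd (u ! i)} \<subseteq> lmarked c k"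
      proof clarify
        fix u assume u: "u \<in> cmarked c k" "\<not> snd (u ! i)"
        have "last (rotate (Suc i) u) = u ! i"
          using last(1)[OF rotate_cmarked[OF u(1)], of "Suc i"] i len[OF u(1)]
          by (simp add: nth_rotate del: rotate_Suc)
        then show "rotate (Suc i) u \<in> lmarked c k"
          using u rotate_cmarked[OF u(1), of "Suc i"] by (simp add: lmarked_def del: rotate_Suc)
      qed
      show "rotate (?N - Suc i) ` lmarked c k \<subseteq> {u \<in> cmarked c k. \<not> snd (u ! i)}"
      proof clarify
        fix u assume u: "u \<in> lmarked c k"
        then have u': "u \<in> cmarked c k" by (simp add: lmarked_def)
        have "rotate (?N - Suc i) u ! i = last u"
          using i len[OF u'] last(1)[OF u'] by (simp add: nth_rotate)
        then show "rotate (?N - Suc i) u \<in> cmarked c k \<and> \<not> snd (rotate (?N - Suc i) u ! i)"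
          using u rotate_cmarked[OF u'] last(2)[OF u'] by (simp add: lmarked_def)
      qed
    qed
    then show "card {u \<in> cmarked c k. \<not> snd (u ! i)} = card (lmarked c k)"
      by (rule bij_betw_same_card)
  qed
  finally show ?thesis by simp
qed

section \<open>Inclusion-exclusion over the sets of marks\<close>

definition incompatibilities :: "letter list \<Rightarrow> nat set"
  where "incompatibilities w = {i. i < length w \<and> \<not> compatible (w ! i) (w ! (Suc i mod length w))}"

definition marks :: "(letter \<times> bool) list \<Rightarrow> nat set"
  where "marks u = {i. i < length u \<and> snd (u ! i)}"

lemma card_marks: "card (marks u) + count_list (map snd u) False = length u"
proof -
  have cnt: "card {i. i < length u \<and> snd (u ! i) = x} = count_list (map snd u) x" for x
    using card_positions_eq_count_list[of "map snd u" x] by (simp cong: conj_cong)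
  have "card (marks u) + count_list (map snd u) False =
      card {i. i < length u \<and> snd (u ! i)} + card {i. i < length u \<and> \<not> snd (u ! i)}"
    using cnt[of False] by (simp add: marks_def)
  also have "\<dots> = card ({i. i < length u \<and> snd (u ! i)} \<union> {i. i < length u \<and> \<not> snd (u ! i)})"
    by (rule card_Un_disjoint[symmetric]) auto
  also have "{i. i < length u \<and> snd (u ! i)} \<union> {i. i < length u \<and> \<not> snd (u ! i)} = {..<length u}"
    by auto
  finally show ?thesis by simp
qed

text \<open>For a fixed word the sets of marks run over all subsets of \<open>A w\<close>, so its
  signed sum is 1 or 0 according to whether \<open>A w\<close> is empty. A free \<open>A\<close>
  serves both linear and cyclic words.\<close>

lemma sum_over_marks:
  assumes "\<And>w. A w \<subseteq> {..<length w}"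
  shows "(\<Sum>u | content (map fst u) = c \<and> marks u \<subseteq> A (map fst u). (- 1) ^ card (marks u)) =
    rat_of_nat (card {w. content w = c \<and> A w = {}})"
proof -
  let ?M = "{u. content (map fst u) = c \<and> marks u \<subseteq> A (map fst u)}"
  \<comment> \<open>Inverse of the map sending a marked word to its letters and its set of
    marks.\<close>
  let ?mark = "\<lambda>(w, S). map (\<lambda>i. (w ! i, i \<in> S)) [0..<length w]"
  have fin: "finite (A w)" for w
    using assms finite_subset by blast
  have fst: "map fst (?mark (w, S)) = w" for w S
    by (simp add: o_def map_nth)
  have marks: "marks (?mark (w, S)) = S" if "S \<subseteq> A w" for w S
    using that assms[of w] by (auto simp: marks_def)
  have "(\<Sum>u\<in>?M. (- 1) ^ card (marks u)) =
      (\<Sum>(w, S)\<in>(SIGMA w : {w. content w = c}. Pow (A w)). (- 1) ^ card S :: rat)"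
  proof (rule sum.reindex_bij_witness[of _ ?mark "\<lambda>u. (map fst u, marks u)"])
    fix u assume "u \<in> ?M"
    show "?mark (map fst u, marks u) = u"
      by (rule nth_equalityI) (auto simp: marks_def prod_eq_iff)
  next
    fix p assume p: "p \<in> (SIGMA w : {w. content w = c}. Pow (A w))"
    obtain w S where "p = (w, S)" by (cases p)
    then show "(map fst (?mark p), marks (?mark p)) = p" "?mark p \<in> ?M"
      using p fst[of w S] marks[of S w] by auto
  qed auto
  also have "\<dots> = (\<Sum>w | content w = c. \<Sum>S\<in>Pow (A w). (- 1) ^ card S)"
    by (rule sum.Sigma[symmetric]) (auto simp: finite_content fin)
  also have "\<dots> = (\<Sum>w | content w = c. if A w = {} then 1 else 0)"
    by (simp only: sum_Pow_minus_one_power_card[OF fin])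
  also have "\<dots> = rat_of_nat (\<Sum>w\<in>{w. content w = c}. if A w = {} then 1 else 0)"
    by (simp add: of_nat_sum if_distrib cong: if_cong)
  also have "\<dots> = rat_of_nat (card {w \<in> {w. content w = c}. A w = {}})"
    by (simp only: card_filter_eq_sum[OF finite_content])
  finally show ?thesis by simp
qed

text \<open>The marked words are grouped by the number \<open>k\<close> of unmarked positions; the
  number of marks is then \<open>weight c - k\<close>, which has the parity of
  \<open>weight c + k\<close>.\<close>

lemma sum_over_marks_by_length:
  assumes "\<And>w. A w \<subseteq> {..<length w}"
  shows "rat_of_nat (card {w. content w = c \<and> A w = {}}) =
    (\<Sum>k\<le>weight c. (- 1) ^ (weight c + k) *
      rat_of_nat (card {u. content (map fst u) = c \<and> marks u \<subseteq> A (map fst u)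
        \<and> count_list (map snd u) False = k}))"
proof -
  let ?M = "{u. content (map fst u) = c \<and> marks u \<subseteq> A (map fst u)}"
  let ?k = "\<lambda>u :: (letter \<times> bool) list. count_list (map snd u) False"
  have len: "card (marks u) + ?k u = weight c" if "u \<in> ?M" for u
    using card_marks[of u] length_eq_weight[of "map fst u"] that by simp
  have fin: "finite ?M"
    by (rule finite_subset[OF _ finite_marked[of c]]) auto
  have "?k ` ?M \<subseteq> {..weight c}" using len by fastforce
  then have "(\<Sum>u\<in>?M. (- 1) ^ card (marks u)) =
      (\<Sum>k\<le>weight c. \<Sum>u\<in>{u \<in> ?M. ?k u = k}. (- 1) ^ card (marks u) :: rat)"
    using fin by (intro sum.group[symmetric]) auto
  also have "\<dots> = (\<Sum>k\<le>weight c. \<Sum>u\<in>{u \<in> ?M. ?k u = k}. (- 1) ^ (weight c + k))"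
  proof (intro sum.cong refl)
    fix k u assume "u \<in> {u \<in> ?M. ?k u = k}"
    then have "weight c + k = card (marks u) + 2 * k" using len[of u] by auto
    then show "(- 1) ^ card (marks u) = (- 1 :: rat) ^ (weight c + k)"
      by (simp add: power_add power_mult)
  qed
  finally show ?thesis
    unfolding sum_over_marks[OF assms] by (simp add: mult.commute conj_assoc)
qed

lemma cyclic_marked_iff: "cyclic_marked u \<longleftrightarrow> marks u \<subseteq> incompatibilities (map fst u)"
proof -
  have "Suc i mod length u < length u" if "i < length u" for i
    using that by (intro mod_less_divisor) auto
  then show ?thesis
    by (auto simp: cyclic_marked_def marks_def incompatibilities_def)
qed

text \<open>For the empty word \<open>length u - 1\<close> is 0, and both sides hold since there are
  no marks.\<close>

lemma last_unmarked_iff: "(u \<noteq> [] \<longrightarrow> \<not> snd (last u)) \<longleftrightarrow> length u - 1 \<notin> marks u"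
proof (cases "u = []")
  case False
  then have "length u - 1 < length u" by simp
  then show ?thesis using False last_conv_nth[OF False] by (auto simp: marks_def)
qed (simp add: marks_def)

text \<open>Only the last position has a successor that wraps around; deleting it leaves the linear
  adjacencies.\<close>

lemma successively_compatible_iff:
  "successively compatible w \<longleftrightarrow> incompatibilities w - {length w - 1} = {}"
proof -
  have "incompatibilities w - {length w - 1} = {i. Suc i < length w \<and> \<not> compatible (w ! i) (w ! Suc i)}"
    by (auto simp: incompatibilities_def)
  then show ?thesis by (auto simp: successively_conv_nth)
qed

text \<open>Inclusion-exclusion with all positions but the last eligible for a mark, so that the
  linear joined words arise.\<close>

lemma card_smirnov_words:
  "rat_of_nat (card {w. content w = c \<and> successively compatible w}) =
    (\<Sum>k\<le>weight c. (- 1) ^ (weight c + k) * rat_of_nat (card (lmarked c k)))"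
proof -
  have "lmarked c k = {u. content (map fst u) = c \<and>
      marks u \<subseteq> incompatibilities (map fst u) - {length (map fst u) - 1}
      \<and> count_list (map snd u) False = k}" for k
    by (auto simp: lmarked_def cmarked_def cyclic_marked_iff last_unmarked_iff)
  then show ?thesis
    unfolding successively_compatible_iff
    using sum_over_marks_by_length[of "\<lambda>w. incompatibilities w - {length w - 1}" c]
    by (auto simp: incompatibilities_def)
qed

text \<open>Here the last position is eligible too, so the cyclic joined words arise,
  \<open>k = 0\<close> included.\<close>

lemma card_cyclic_smirnov_words:
  "rat_of_nat (card {w. content w = c \<and> incompatibilities w = {}}) =
    (\<Sum>k\<le>weight c. (- 1) ^ (weight c + k) * rat_of_nat (card (cmarked c k)))"
proof -
  have "cmarked c k = {u. content (map fst u) = c \<and> marks u \<subseteq> incompatibilities (map fst u)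
      \<and> count_list (map snd u) False = k}" for k
    by (auto simp: cmarked_def cyclic_marked_iff)
  then show ?thesis
    using sum_over_marks_by_length[of incompatibilities c]
    by (auto simp: incompatibilities_def)
qed


section \<open>Linear joined words as sequences of blocks\<close>

text \<open>
  A block \<open>(a, m)\<close> is a maximal run of joined positions. Blocks of content \<open>c\<close> correspond to the
  terms of \<open>z + p\<^sub>1 - p\<^sub>2 + \<dots>\<close>.
\<close>

definition blocks :: "(letter \<times> nat) set"
  where "blocks = {(a, m). m > 0 \<and> (a = None \<longrightarrow> m = 1)}"

text \<open>The value for \<open>None\<close> grows with \<open>m\<close>, so that lengthening a
  block by one letter adds the content of that letter for every \<open>a\<close> and
  \<open>m\<close>.\<close>

definition block_content :: "letter \<times> nat \<Rightarrow> nat \<times> expo"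
  where "block_content = (\<lambda>(a, m). case a of None \<Rightarrow> (m, 0) | Some i \<Rightarrow> (0, Poly_Mapping.single i m))"

lemma block_content_1: "block_content (a, Suc 0) = letter_content a"
  by (simp add: block_content_def letter_content_def split: option.split)

lemma block_content_Suc: "block_content (a, Suc m) = letter_content a + block_content (a, m)"
  by (simp add: block_content_def letter_content_def flip: single_add split: option.split)

text \<open>The condition of \<open>lmarked\<close> in a form suited to induction from the front;
  \<open>u \<noteq> []\<close> keeps the last mark unset.\<close>

fun linear_marked :: "(letter \<times> bool) list \<Rightarrow> bool" where
  "linear_marked [] \<longleftrightarrow> True"
| "linear_marked ((a, b) # u) \<longleftrightarrow> linear_marked u \<and> (b \<longrightarrow> u \<noteq> [] \<and> \<not> compatible a (fst (hd u)))"

lemma linear_marked_conv_nth: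
  "linear_marked u \<longleftrightarrow>
    (\<forall>i<length u. snd (u ! i) \<longrightarrow> Suc i < length u \<and> \<not> compatible (fst (u ! i)) (fst (u ! Suc i)))"
proof (induction u rule: linear_marked.induct)
  case (2 a b u)
  then show ?case by (cases u) (auto simp: All_less_Suc2)
qed simp

text \<open>Before the last position the cyclic successor is the ordinary one, and an unmarked last
  position makes the wrap-around condition void.\<close>

lemma linear_marked_iff:
  "linear_marked u \<longleftrightarrow> cyclic_marked u \<and> (u \<noteq> [] \<longrightarrow> \<not> snd (last u))"
proof (cases "u = []")
  case False
  then have l: "last u = u ! (length u - 1)" "length u > 0" by (simp_all add: last_conv_nth)
  show ?thesis
  proof
    assume u: "linear_marked u"
    then have "\<not> snd (last u)" using l unfolding linear_marked_conv_nth
      by (metis Suc_diff_1 diff_less less_irrefl zero_less_one)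
    moreover have "cyclic_marked u"
      using u unfolding linear_marked_conv_nth cyclic_marked_def by (metis mod_less)
    ultimately show "cyclic_marked u \<and> (u \<noteq> [] \<longrightarrow> \<not> snd (last u))" by simp
  next
    assume u: "cyclic_marked u \<and> (u \<noteq> [] \<longrightarrow> \<not> snd (last u))"
    show "linear_marked u"
      unfolding linear_marked_conv_nth
    proof (intro allI impI)
      fix i assume i: "i < length u" "snd (u ! i)"
      then have "i \<noteq> length u - 1" using u l by auto
      then have "Suc i < length u" using i by simp
      then show "Suc i < length u \<and> \<not> compatible (fst (u ! i)) (fst (u ! Suc i))"
        using u i unfolding cyclic_marked_def by (metis mod_less)
    qed
  qed
qed (simp add: cyclic_marked_def)

fun expand :: "(letter \<times> nat) list \<Rightarrow> (letter \<times> bool) list" where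
  "expand [] = []"
| "expand ((a, m) # bs) = replicate (m - 1) (a, True) @ (a, False) # expand bs"

text \<open>A marked letter lengthens the block that follows it. The value \<open>[]\<close> in the
  last clause is a default that linear joined words do not reach.\<close>

fun compress :: "(letter \<times> bool) list \<Rightarrow> (letter \<times> nat) list" where
  "compress [] = []"
| "compress ((a, False) # u) = (a, 1) # compress u"
| "compress ((a, True) # u) = (case compress u of [] \<Rightarrow> [] | (b, m) # bs \<Rightarrow> (b, Suc m) # bs)"

lemma compress_block:
  "compress (replicate m (a, True) @ (a, False) # u) = (a, Suc m) # compress u"
  by (induction m) simp_all

lemma linear_marked_block:
  assumes "linear_marked u" and "m = 0 \<or> a \<noteq> None"
  shows "linear_marked (replicate m (a, True) @ (a, False) # u)"
  using assms(2)
proof (induction m)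
  case (Suc m)
  have "fst (hd (replicate m (a, True) @ (a, False) # u)) = a" by (cases m) simp_all
  then show ?case using Suc by (simp add: compatible_def)
qed (simp add: assms(1))

lemma expand_blocks:
  assumes "set bs \<subseteq> blocks"
  shows "linear_marked (expand bs)" and "compress (expand bs) = bs"
  using assms
  by (induction bs rule: expand.induct) (auto simp: blocks_def compress_block intro!: linear_marked_block)

text \<open>The last conjunct records that the first block carries the first letter; the induction
  needs it when a marked letter is merged with the block after it.\<close>

lemma compress_linear_marked:
  assumes "linear_marked u"
  shows "set (compress u) \<subseteq> blocks \<and> expand (compress u) = u \<and>
    length (compress u) = count_list (map snd u) False \<and>
    sum_list (map block_content (compress u)) = content (map fst u) \<and>
    map fst (take 1 (compress u)) = map fst (take 1 u)"
  using assms
proof (induction u rule: compress.induct)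
  case (3 a u)
  \<comment> \<open>A mark on \<open>a\<close> requires an incompatible successor, hence the same
    letter, and that letter is not z.\<close>
  then obtain b v where u: "u = (a, b) # v" and a: "a \<noteq> None"
    by (cases u) (auto simp: compatible_def)
  with 3 obtain m bs where c: "compress u = (a, m) # bs"
    by (cases "compress u") auto
  moreover obtain k where "m = Suc k" using 3 c by (cases m) (auto simp: blocks_def)
  ultimately show ?case
    using 3 a by (auto simp: blocks_def block_content_Suc add.assoc)
qed (auto simp: blocks_def block_content_1)

text \<open>Cutting after each unmarked position is a bijection, with \<open>compress\<close> and
  \<open>expand\<close> as inverse maps.\<close>

lemma card_lmarked:
  "card (lmarked c k) = card (weighted_lists blocks block_content k c)"
proof -
  have l: "lmarked c k = {u. content (map fst u) = c \<and> linear_marked u \<and> count_list (map snd u) False = k}"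
    by (auto simp: lmarked_def cmarked_def linear_marked_iff)
  have "bij_betw compress (lmarked c k) (weighted_lists blocks block_content k c)"
  proof (rule bij_betw_byWitness[where f' = expand])
    show "\<forall>u\<in>lmarked c k. expand (compress u) = u"
      using compress_linear_marked by (simp add: l)
    show "\<forall>bs\<in>weighted_lists blocks block_content k c. compress (expand bs) = bs"
      using expand_blocks by (simp add: weighted_lists_def)
    show "compress ` lmarked c k \<subseteq> weighted_lists blocks block_content k c"
      using compress_linear_marked by (auto simp: l weighted_lists_def)
    show "expand ` weighted_lists blocks block_content k c \<subseteq> lmarked c k"
    proof clarify
      fix bs assume bs: "bs \<in> weighted_lists blocks block_content k c"
      then have "linear_marked (expand bs)" "compress (expand bs) = bs"
        using expand_blocks by (simp_all add: weighted_lists_def)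
      then show "expand bs \<in> lmarked c k"
        unfolding l using bs compress_linear_marked[of "expand bs"] by (simp add: weighted_lists_def)
    qed
  qed
  then show ?thesis by (rule bij_betw_same_card)
qed

section \<open>Coefficients of the step series, its powers, the geometric series and the
  logarithm\<close>

section \<open>Coefficients of the generating functions\<close>

text \<open>The exponents of z and of the variables form one index, so that a product becomes one
  sum over the decompositions \<open>x + y = c\<close>.\<close>

definition coef :: "symf fps \<Rightarrow> nat \<times> expo \<Rightarrow> rat"
  where "coef F c = scoeff (F $ fst c) (snd c)"

lemma symf_fps_eqI: "(\<And>c. coef F c = coef G c) \<Longrightarrow> F = G"
  by (intro fps_ext symf_eqI) (metis coef_def fst_conv snd_conv)

lemma coef_simps [simp]:
  "coef (F + G) c = coef F c + coef G c" "coef (F - G) c = coef F c - coef G c"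
  "coef (- F) c = - coef F c" "coef (r *\<^sub>Q F) c = r * coef F c"
  by (simp_all add: coef_def plus_symf.rep_eq minus_symf.rep_eq uminus_symf.rep_eq scoeff_scaleQ)

lemma coef_1: "coef 1 c = (if c = 0 then 1 else 0)"
  by (cases c) (simp add: coef_def one_symf.rep_eq zero_symf.rep_eq zero_prod_def)

lemma coef_fps_X: "coef fps_X c = (if c = (1, 0) then 1 else 0)"
  by (cases c) (simp add: coef_def one_symf.rep_eq zero_symf.rep_eq)

lemma coef_sum: "coef (sum F A) c = (\<Sum>i\<in>A. coef (F i) c)"
  by (simp add: coef_def fps_sum_nth scoeff_sum)

lemma decompositions_eq:
  "{(x, y). x + y = c} = (\<lambda>(i, \<beta>, \<gamma>). ((i, \<beta>), (fst c - i, \<gamma>))) ` ({0..fst c} \<times> splits (snd c))"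
  for c :: "nat \<times> expo"
  by (cases c) (force simp: splits_def image_iff)

lemma finite_decompositions: "finite {(x, y). x + y = c}" for c :: "nat \<times> expo"
  unfolding decompositions_eq by (intro finite_imageI finite_cartesian_product finite_splits) simp

lemma coef_mult: "coef (F * G) c = (\<Sum>(x, y)\<in>{(x, y). x + y = c}. coef F x * coef G y)"
proof -
  have inj: "inj_on (\<lambda>(i, \<beta>, \<gamma>). ((i, \<beta>), (fst c - i, \<gamma>))) ({0..fst c} \<times> splits (snd c))"
    by (auto simp: inj_on_def)
  have "coef (F * G) c = (\<Sum>i=0..fst c. \<Sum>(\<beta>, \<gamma>)\<in>splits (snd c).
      scoeff (F $ i) \<beta> * scoeff (G $ (fst c - i)) \<gamma>)"
    by (simp add: coef_def fps_mult_nth scoeff_sum scoeff_mult)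
  also have "\<dots> = (\<Sum>(i, \<beta>, \<gamma>)\<in>{0..fst c} \<times> splits (snd c).
      scoeff (F $ i) \<beta> * scoeff (G $ (fst c - i)) \<gamma>)"
    by (simp add: sum.cartesian_product case_prod_unfold)
  also have "\<dots> = (\<Sum>(x, y)\<in>{(x, y). x + y = c}. coef F x * coef G y)"
    unfolding decompositions_eq sum.reindex[OF inj] by (simp add: case_prod_unfold coef_def)
  finally show ?thesis .
qed

lemma coef_of_nat_mult: "coef (of_nat k * F) c = of_nat k * coef F c"
proof (induction k)
  case (Suc k)
  then show ?case by (simp add: distrib_right)
qed (simp add: coef_def zero_symf.rep_eq)

lemma coef_formal_sum: "coef (formal_sum F A) c = (\<Sum>i\<in>{i \<in> A. coef (F i) c \<noteq> 0}. coef (F i) c)"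
  by (simp add: coef_def formal_sum_def symf_sum.rep_eq)

lemma single_eq_iff:
  fixes m :: nat
  assumes "m > 0"
  shows "Poly_Mapping.single i m = Poly_Mapping.single j n \<longleftrightarrow> i = j \<and> m = n"
  using assms by (metis lookup_single_eq lookup_single_not_eq neq0_conv)

definition is_single :: "nat \<times> expo \<Rightarrow> bool"
  where "is_single c \<longleftrightarrow> (\<exists>i m. m > 0 \<and> c = (0, Poly_Mapping.single i m))"

lemma weight_pos_of_single: "is_single c \<Longrightarrow> weight c > 0"
  by (auto simp: is_single_def)

lemma coef_power_sum:
  assumes "m > 0"
  shows "coef (fps_const (power_sum m)) c = (if is_single c \<and> m = weight c then 1 else 0)"
proof (cases c)
  case (Pair n \<alpha>)
  have "(\<exists>i. \<alpha> = Poly_Mapping.single i m) \<longleftrightarrow> is_single (0, \<alpha>) \<and> m = tdeg \<alpha>"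
    using assms by (auto simp: is_single_def)
  then show ?thesis
    using Pair by (auto simp: coef_def power_sum.rep_eq zero_symf.rep_eq is_single_def)
qed

text \<open>The monomial x_i^m occurs in the power sum of index \<open>m\<close> alone, so at most
  one summand contributes.\<close>

lemma coef_sum_power_sums:
  "coef (formal_sum (\<lambda>m. a m *\<^sub>Q fps_const (power_sum m)) {1..}) c =
    (if is_single c then a (weight c) else 0)"
proof -
  define f where "f m = coef (a m *\<^sub>Q fps_const (power_sum m)) c" for m
  have f: "f m = (if is_single c \<and> m = weight c then a (weight c) else 0)" if "m > 0" for m
    using that by (simp add: f_def coef_power_sum)
  note w = weight_pos_of_single[of c]
  have "(\<Sum>m\<in>{m \<in> {1..}. f m \<noteq> 0}. f m) = (\<Sum>m\<in>(if is_single c then {weight c} else {}). f m)"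
    using w by (intro sum.mono_neutral_left) (auto simp: f split: if_splits)
  moreover have "(\<Sum>m\<in>(if is_single c then {weight c} else {}). f m) =
      (if is_single c then a (weight c) else 0)"
    using w by (simp add: f)
  ultimately show ?thesis
    by (simp only: coef_formal_sum f_def)
qed

definition step_series :: "symf fps"
  where "step_series = fps_X + alt_power_sums"

lemma block_content_cases:
  "b \<in> blocks \<Longrightarrow> block_content b = (1, 0) \<or> is_single (block_content b)"
  by (cases b) (auto simp: blocks_def block_content_def is_single_def split: option.splits)

text \<open>z comes from the block \<open>(None, 1)\<close> alone and x_i^m from
  \<open>(Some i, m)\<close> alone.\<close>

lemma blocks_of_content:
  "card {b \<in> blocks. block_content b = c} = (if c = (1, 0) \<or> is_single c then 1 else 0)"
proof -
  consider (X) "c = (1, 0)" | (S) i m where "m > 0" "c = (0, Poly_Mapping.single i m)"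
    | (N) "c \<noteq> (1, 0)" "\<not> is_single c"
    by (auto simp: is_single_def)
  then show ?thesis
  proof cases
    case X
    then have "{b \<in> blocks. block_content b = c} = {(None, 1)}"
      by (auto simp: blocks_def block_content_def split: option.splits)
    then show ?thesis using X by simp
  next
    case S
    then have "{b \<in> blocks. block_content b = c} = {(Some i, m)}"
      by (auto simp: blocks_def block_content_def single_eq_iff split: option.splits)
    then show ?thesis using S by (auto simp: is_single_def)
  next
    case N
    then have "{b \<in> blocks. block_content b = c} = {}"
      using block_content_cases by blast
    then show ?thesis using N by (simp only: card.empty) simp
  qed
qed

text \<open>Infinite sets have cardinality 0, whereas \<open>blocks_of_content\<close> gives 1 as
  soon as some block has this content.\<close>

lemma finite_blocks_of_content: "finite {b \<in> blocks. block_content b = c}"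
proof (rule ccontr)
  assume inf: "infinite {b \<in> blocks. block_content b = c}"
  then obtain b where b: "b \<in> blocks" "block_content b = c"
    by (metis (mono_tags, lifting) empty_Collect_eq finite.emptyI)
  then have "c = (1, 0) \<or> is_single c"
    using block_content_cases by blast
  then show False
    using inf blocks_of_content[of c] by simp
qed

text \<open>Both kinds of blocks obey one sign rule: z has weight 1 and sign plus, x_i^m has weight
  \<open>m\<close> and sign (-1)^(m-1).\<close>

lemma coef_step_series:
  "coef step_series c = (- 1) ^ (weight c + 1) * of_nat (card {b \<in> blocks. block_content b = c})"
proof -
  have "coef step_series c =
      (if c = (1, 0) then 1 else 0) + (if is_single c then (- 1) ^ (weight c - 1) else 0)"
    by (simp only: step_series_def alt_power_sums_def coef_simps(1) coef_fps_X coef_sum_power_sums)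
  moreover have "(- 1 :: rat) ^ (weight c - 1) = (- 1) ^ (weight c + 1)" if "is_single c"
    using that by (auto simp: is_single_def power_eq_if)
  moreover have "c \<noteq> (1, 0)" if "is_single c"
    using that by (auto simp: is_single_def)
  ultimately show ?thesis
    by (auto simp: blocks_of_content)
qed

text \<open>Each block contributes the sign (-1)^(weight + 1) and weights add along the list, so the
  sign comes out of the Cauchy product. Finiteness is carried along because the recursion for the
  cardinalities asks for it.\<close>

lemma coef_step_series_power:
  "finite (weighted_lists blocks block_content k c) \<and>
    coef (step_series ^ k) c =
      (- 1) ^ (weight c + k) * of_nat (card (weighted_lists blocks block_content k c))"
proof (induction k arbitrary: c)
  case 0
  then show ?case by (simp add: weighted_lists_0 coef_1)
next
  case (Suc k)
  let ?L = "weighted_lists blocks block_content"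
  note L = card_weighted_lists_Suc[OF finite_decompositions finite_blocks_of_content
      conjunct1[OF Suc.IH], of c]
  have "coef (step_series ^ Suc k) c =
      (\<Sum>(x, y)\<in>{(x, y). x + y = c}. coef step_series x * coef (step_series ^ k) y)"
    by (simp only: power_Suc coef_mult)
  also have "\<dots> = (\<Sum>(x, y)\<in>{(x, y). x + y = c}. (- 1) ^ (weight c + Suc k) *
      (of_nat (card {b \<in> blocks. block_content b = x}) * of_nat (card (?L k y))))"
  proof (intro sum.cong refl, clarify)
    fix x y :: "nat \<times> expo" assume "c = x + y"
    then show "coef step_series x * coef (step_series ^ k) y = (- 1) ^ (weight (x + y) + Suc k) *
      (of_nat (card {b \<in> blocks. block_content b = x}) * of_nat (card (?L k y)))"
      using Suc.IH[of y] by (simp add: coef_step_series power_add)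
  qed
  also have "\<dots> = (- 1) ^ (weight c + Suc k) * of_nat (card (?L (Suc k) c))"
    unfolding L(2) by (simp add: sum_distrib_left case_prod_unfold)
  finally show ?case using L(1) by simp
qed

lemma coef_step_series_power_lmarked:
  "coef (step_series ^ k) c = (- 1) ^ (weight c + k) * of_nat (card (lmarked c k))"
  using coef_step_series_power by (simp add: card_lmarked)

lemma step_series_constant: "scoeff (step_series $ 0) 0 = 0"
  by (simp add: step_series_def plus_symf.rep_eq zero_symf.rep_eq scoeff_alt_power_sums_0)

lemma coef_step_series_power_eq_0: "weight c < k \<Longrightarrow> coef (step_series ^ k) c = 0"
  using scoeff_fps_power_eq_0[OF step_series_constant] by (simp add: coef_def weight_def)

text \<open>With s the step series and N above the weight, 1/(1-s) is the sum of s^k for k < N plus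
  a multiple of s^N, which does not reach this coefficient.\<close>

lemma coef_geometric:
  "coef (1 / (1 - step_series)) c = (\<Sum>k\<le>weight c. coef (step_series ^ k) c)"
proof -
  let ?G = "1 / (1 - step_series)" and ?N = "Suc (weight c)"
  have "?G * (1 - step_series) = 1"
    unfolding step_series_def by (rule fps_divide_makes_sense[OF scoeff_one_minus])
  then have "?G * (1 - step_series ^ ?N) = (\<Sum>k<?N. step_series ^ k)"
    unfolding one_diff_power_eq by (simp add: mult.assoc[symmetric])
  then have "?G = (\<Sum>k<?N. step_series ^ k) + ?G * step_series ^ ?N"
    by (simp add: algebra_simps)
  moreover have "coef (?G * step_series ^ ?N) c = 0"
    unfolding coef_mult
  proof (rule sum.neutral, clarify)
    fix x y assume "c = x + y"
    then have "weight y < Suc (weight (x + y))" by simp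
    then show "coef ?G x * coef (step_series ^ Suc (weight (x + y))) y = 0"
      by (simp only: coef_step_series_power_eq_0 mult_zero_right)
  qed
  ultimately have "coef ?G c = coef (\<Sum>k<?N. step_series ^ k) c"
    by (metis coef_simps(1) add.right_neutral)
  then show ?thesis by (simp only: coef_sum lessThan_Suc_atMost)
qed

text \<open>The sign in the logarithm and that of the power of \<open>- step_series\<close> multiply
  to -1 for every \<open>k\<close>; powers beyond the weight contribute nothing.\<close>

lemma coef_formal_ln:
  "coef (formal_ln (1 - step_series)) c = - (\<Sum>k=1..weight c. coef (step_series ^ k) c / of_nat k)"
proof -
  let ?f = "\<lambda>k. coef (((- 1) ^ (k - 1) / of_nat k) *\<^sub>Q (1 - step_series - 1) ^ k) c"
  have f: "?f k = - (coef (step_series ^ k) c / of_nat k)" if "k > 0" for k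
  proof -
    have "(1 - step_series - 1) ^ k = (- step_series) ^ k" by simp
    also have "\<dots> = (if even k then step_series ^ k else - (step_series ^ k))"
      by (simp add: power_minus_odd)
    finally have "coef ((1 - step_series - 1) ^ k) c = (- 1) ^ k * coef (step_series ^ k) c"
      by simp
    moreover have "(- 1) ^ (k - 1) * (- 1) ^ k = (- 1 :: rat)"
      using that by (cases k) (simp_all flip: power_add power_mult_distrib)
    ultimately show ?thesis by (simp add: mult.assoc[symmetric])
  qed
  have "(\<Sum>k\<in>{k \<in> {1..}. ?f k \<noteq> 0}. ?f k) = (\<Sum>k=1..weight c. ?f k)"
  proof (rule sum.mono_neutral_left)
    show "{k \<in> {1..}. ?f k \<noteq> 0} \<subseteq> {1..weight c}"
    proof
      fix k assume "k \<in> {k \<in> {1..}. ?f k \<noteq> 0}"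
      then have k: "k > 0" "?f k \<noteq> 0" by auto
      then have "coef (step_series ^ k) c \<noteq> 0" using f[of k] by auto
      then have "\<not> weight c < k" using coef_step_series_power_eq_0 by blast
      then show "k \<in> {1..weight c}" using k by simp
    qed
  qed auto
  also have "\<dots> = (\<Sum>k=1..weight c. - (coef (step_series ^ k) c / of_nat k))"
    by (intro sum.cong refl f) simp
  finally show ?thesis
    by (simp add: formal_ln_def coef_formal_sum sum_negf)
qed

section \<open>Comparison of the two series with counts of words\<close>

lemma coef_geometric_eq_card:
  "coef (1 / (1 - step_series)) c = of_nat (card {w. content w = c \<and> successively compatible w})"
  by (simp add: coef_geometric card_smirnov_words coef_step_series_power_lmarked)

text \<open>With all positions joined, equality of letters propagates along the word, which is then
  constant in some x_j.\<close>

lemma card_cmarked_0: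
  assumes "weight c > 0"
  shows "card (cmarked c 0) = (if is_single c then 1 else 0)"
proof -
  have const: "u = replicate (weight c) (Some j, True)"
    if "u \<in> cmarked c 0" "fst (u ! 0) = Some j" for u j
  proof -
    have len: "length u = weight c"
      using that length_eq_weight[of "map fst u"] by (auto simp: cmarked_def)
    have T: "snd (u ! i)" if "i < length u" for i
      using \<open>u \<in> cmarked c 0\<close> that by (auto simp: cmarked_def count_list_0_iff)
    have "fst (u ! i) = Some j" if "i < length u" for i
      using that
    proof (induction i)
      case (Suc i)
      then have "\<not> compatible (fst (u ! i)) (fst (u ! Suc i))"
        using \<open>u \<in> cmarked c 0\<close> T[of i] by (auto simp: cmarked_def cyclic_marked_def dest!: spec[of _ i])
      then show ?case using Suc by (auto simp: compatible_def)
    qed (rule \<open>fst (u ! 0) = Some j\<close>)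
    then show ?thesis
      using T len by (intro nth_equalityI) (auto simp: prod_eq_iff)
  qed
  \<comment> \<open>The mark at position 0 needs an incompatible pair, which excludes the letter z
    there.\<close>
  have nonempty: "\<exists>j. fst (u ! 0) = Some j" if "u \<in> cmarked c 0" for u
  proof -
    have "length u > 0"
      using that assms length_eq_weight[of "map fst u"] by (auto simp: cmarked_def)
    moreover have "snd (u ! 0)"
      using that \<open>length u > 0\<close> by (auto simp: cmarked_def count_list_0_iff)
    ultimately have "\<not> compatible (fst (u ! 0)) (fst (u ! (Suc 0 mod length u)))"
      using that by (auto simp: cmarked_def cyclic_marked_def)
    then show ?thesis by (auto simp: compatible_def)
  qed
  have content: "content (replicate m (Some j)) = (0, Poly_Mapping.single j m)" for m j
    by (induction m) (simp_all add: zero_prod_def letter_content_def flip: single_add)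
  show ?thesis
  proof (cases "is_single c")
    case True
    then obtain j m where c: "m > 0" "c = (0, Poly_Mapping.single j m)" by (auto simp: is_single_def)
    have "cmarked c 0 = {replicate m (Some j, True)}"
    proof (intro equalityI subsetI)
      fix u assume u: "u \<in> cmarked c 0"
      obtain i where i: "u = replicate m (Some i, True)"
        using nonempty[OF u] const[OF u] c by auto
      then have "(0, Poly_Mapping.single i m) = (0 :: nat, Poly_Mapping.single j m)"
        using u c content by (simp add: cmarked_def)
      then show "u \<in> {replicate m (Some j, True)}"
        using i c by (simp add: single_eq_iff)
    next
      fix u assume "u \<in> {replicate m (Some j, True)}"
      then show "u \<in> cmarked c 0"
        using c content by (auto simp: cmarked_def cyclic_marked_def compatible_def count_list_0_iff)
    qed
    then show ?thesis using True by simp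
  next
    case False
    have "u \<notin> cmarked c 0" for u
    proof
      assume u: "u \<in> cmarked c 0"
      obtain j where "u = replicate (weight c) (Some j, True)"
        using nonempty[OF u] const[OF u] by auto
      then have "c = (0, Poly_Mapping.single j (weight c))"
        using u content by (simp add: cmarked_def)
      then show False using False assms unfolding is_single_def by blast
    qed
    then have "cmarked c 0 = {}" by blast
    then show ?thesis using False by simp
  qed
qed

text \<open>The relation k C_k = N L_k replaces L_k / k by C_k / N. The logarithm starts at
  \<open>k = 1\<close>, and the power sum term is the missing summand for
  \<open>k = 0\<close>.\<close>

lemma coef_log_eq_card:
  assumes "weight c > 0"
  shows "coef (- formal_ln (1 - step_series)) c
      + (if is_single c then (- 1) ^ weight c / of_nat (weight c) else 0) =
    of_nat (card {w. content w = c \<and> incompatibilities w = {}}) / of_nat (weight c)"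
proof -
  let ?N = "weight c"
  have "coef (step_series ^ k) c / of_nat k =
      (- 1) ^ (?N + k) * of_nat (card (cmarked c k)) / of_nat ?N" if "k \<in> {1..?N}" for k
  proof -
    have "rat_of_nat k * of_nat (card (cmarked c k)) = of_nat ?N * of_nat (card (lmarked c k))"
      by (metis card_cmarked_lmarked of_nat_mult)
    then have "rat_of_nat (card (lmarked c k)) / of_nat k = of_nat (card (cmarked c k)) / of_nat ?N"
      using that assms by (simp add: field_simps)
    then show ?thesis
      unfolding coef_step_series_power_lmarked by (metis times_divide_eq_right)
  qed
  then have "coef (- formal_ln (1 - step_series)) c =
      (\<Sum>k=1..?N. (- 1) ^ (?N + k) * of_nat (card (cmarked c k)) / of_nat ?N)"
    by (simp add: coef_formal_ln)
  moreover have "{..?N} = insert 0 {1..?N}" by auto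
  ultimately show ?thesis
    unfolding card_cyclic_smirnov_words
    by (simp add: card_cmarked_0[OF assms] sum_divide_distrib add_divide_distrib)
qed

section \<open>Hamiltonian orderings as arrangements of coloured vertices\<close>

section \<open>From words to Hamiltonian paths and cycles\<close>

lemma finite_arrangements:
  assumes "finite V"
  shows "finite {vs. distinct vs \<and> set vs = V \<and> P vs}"
proof (rule finite_subset)
  show "{vs. distinct vs \<and> set vs = V \<and> P vs} \<subseteq> {vs. set vs \<subseteq> V \<and> length vs = card V}"
    by (auto dest: distinct_card)
qed (rule finite_lists_length_eq[OF assms])

text \<open>The vertices of each colour may be permuted freely among the positions of that colour.
  The induction removes the first vertex, with \<open>C\<close> kept fixed while \<open>V\<close>
  shrinks.\<close>

lemma card_arrangements_of_word:
  assumes "finite V" and "finite C" and "g ` V \<subseteq> C"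
    and "\<And>x. count_list w x = card {v \<in> V. g v = x}"
  shows "card {vs. distinct vs \<and> set vs = V \<and> map g vs = w} = (\<Prod>x\<in>C. fact (card {v \<in> V. g v = x}))"
  using assms(1,3,4)
proof (induction w arbitrary: V)
  case Nil
  have "V = {}"
  proof (rule ccontr)
    assume "V \<noteq> {}"
    then obtain v where "v \<in> V" by blast
    then have "v \<in> {u \<in> V. g u = g v}" by simp
    then show False using Nil(1) Nil(3)[of "g v"] by (auto simp: card_eq_0_iff)
  qed
  then have "{vs. distinct vs \<and> set vs = V \<and> map g vs = []} = {[]}" by auto
  then show ?case using \<open>V = {}\<close> by simp
next
  case (Cons a w)
  let ?V = "\<lambda>x. {v \<in> V. g v = x}"
  let ?A = "\<lambda>U w. {vs. distinct vs \<and> set vs = U \<and> map g vs = w}"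
  have fin: "finite (?V x)" for x using Cons.prems(1) by simp
  \<comment> \<open>Removing \<open>v\<close> lowers the class of colour \<open>a\<close> by one and
    leaves the others unchanged.\<close>
  have IH: "card (?A (V - {v}) w) = fact (card (?V a) - 1) * (\<Prod>x\<in>C - {a}. fact (card (?V x)))"
    if v: "v \<in> ?V a" for v
  proof -
    have diff: "card {u \<in> V - {v}. g u = x} = (if x = a then card (?V a) - 1 else card (?V x))" for x
    proof (cases "x = a")
      case True
      then have "{u \<in> V - {v}. g u = x} = ?V a - {v}" by auto
      then show ?thesis using v True fin by simp
    next
      case False
      then have "{u \<in> V - {v}. g u = x} = ?V x" using v by auto
      then show ?thesis using False by simp
    qed
    have "card (?A (V - {v}) w) = (\<Prod>x\<in>C. fact (card {u \<in> V - {v}. g u = x}))"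
    proof (rule Cons.IH)
      show "count_list w x = card {u \<in> V - {v}. g u = x}" for x
        unfolding diff using Cons.prems(3)[of x] by (auto split: if_splits)
    qed (use Cons.prems in auto)
    also have "\<dots> = (\<Prod>x\<in>C. fact (if x = a then card (?V a) - 1 else card (?V x)))"
      by (simp only: diff)
    also have "\<dots> = fact (card (?V a) - 1) * (\<Prod>x\<in>C - {a}. fact (card (?V x)))"
      using v Cons.prems(2) by (subst prod.remove[OF assms(2), of a]) auto
    finally show ?thesis .
  qed
  have card_a: "card (?V a) > 0" using Cons.prems(3)[of a] by (metis count_list.simps(2) zero_less_Suc Suc_eq_plus1)
  then have "?V a \<noteq> {}" by (metis card.empty less_irrefl)
  then have a: "a \<in> C" using Cons.prems(2) by auto
  have "?A V (a # w) = (\<lambda>(v, vs). v # vs) ` (SIGMA v : ?V a. ?A (V - {v}) w)"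
  proof (intro equalityI subsetI)
    fix vs assume "vs \<in> ?A V (a # w)"
    then obtain v us where "vs = v # us" "v \<in> ?V a" "us \<in> ?A (V - {v}) w"
      by (cases vs) auto
    then show "vs \<in> (\<lambda>(v, vs). v # vs) ` (SIGMA v : ?V a. ?A (V - {v}) w)"
      by (intro image_eqI[of _ _ "(v, us)"]) simp_all
  next
    fix vs assume "vs \<in> (\<lambda>(v, vs). v # vs) ` (SIGMA v : ?V a. ?A (V - {v}) w)"
    then obtain v us where v: "vs = v # us" "v \<in> ?V a" and us: "us \<in> ?A (V - {v}) w"
      by (elim imageE SigmaE) simp
    have "insert v (V - {v}) = V" using v by blast
    then show "vs \<in> ?A V (a # w)" using v us by simp
  qed
  moreover have "inj_on (\<lambda>(v, vs). v # vs) (SIGMA v : ?V a. ?A (V - {v}) w)"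
    by (rule inj_on_subset[OF _ subset_UNIV]) (simp add: inj_def)
  ultimately have "card (?A V (a # w)) = card (SIGMA v : ?V a. ?A (V - {v}) w)"
    by (simp add: card_image)
  also have "\<dots> = (\<Sum>v\<in>?V a. card (?A (V - {v}) w))"
    using fin Cons.prems(1) by (intro card_SigmaI ballI finite_arrangements) auto
  also have "\<dots> = card (?V a) * (fact (card (?V a) - 1) * (\<Prod>x\<in>C - {a}. fact (card (?V x))))"
    by (simp add: IH)
  also have "\<dots> = fact (card (?V a)) * (\<Prod>x\<in>C - {a}. fact (card (?V x)))"
    using fact_reduce[OF card_a, where 'a = nat] by simp
  also have "\<dots> = (\<Prod>x\<in>C. fact (card (?V x)))"
    by (rule prod.remove[OF assms(2) a, symmetric])
  finally show ?case .
qed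

text \<open>Every ordering of the vertices spells a word of content \<open>(n, \<alpha>)\<close>,
  and all such words are spelled by equally many orderings.\<close>

lemma card_arrangements:
  fixes g :: "'v \<Rightarrow> letter"
  assumes V: "finite V" and None: "card {v \<in> V. g v = None} = n"
    and Some: "\<And>i. card {v \<in> V. g v = Some i} = Poly_Mapping.lookup \<alpha> i"
  shows "card {vs. distinct vs \<and> set vs = V \<and> P (map g vs)} =
      fact n * (\<Prod>i\<in>Poly_Mapping.keys \<alpha>. fact (Poly_Mapping.lookup \<alpha> i)) *
      card {w. content w = (n, \<alpha>) \<and> P w}"
    and "distinct vs \<Longrightarrow> set vs = V \<Longrightarrow> length vs = weight (n, \<alpha>)"
proof -
  let ?A = "\<lambda>w. {vs. distinct vs \<and> set vs = V \<and> map g vs = w}"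
  let ?C = "insert None (Some ` Poly_Mapping.keys \<alpha>)"
  let ?W = "{w. content w = (n, \<alpha>) \<and> P w}"
  have count: "count_list (map g vs) x = card {v \<in> V. g v = x}" if "distinct vs" "set vs = V" for vs x
  proof -
    have "count_list (map g vs) x = length (filter (\<lambda>v. g v = x) vs)"
      by (simp add: count_list_eq_length_filter filter_map o_def eq_commute)
    also have "\<dots> = card (set (filter (\<lambda>v. g v = x) vs))"
      using that by (intro distinct_card[symmetric]) simp
    finally show ?thesis using that by simp
  qed
  have cont: "content (map g vs) = (n, \<alpha>)" if "distinct vs" "set vs = V" for vs
    unfolding content_eq_iff by (simp add: count[OF that] None Some)
  then show "distinct vs \<Longrightarrow> set vs = V \<Longrightarrow> length vs = weight (n, \<alpha>)"
    by (metis length_eq_weight length_map)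
  have C: "g ` V \<subseteq> ?C"
  proof clarify
    fix v assume v: "v \<in> V" "g v \<notin> Some ` Poly_Mapping.keys \<alpha>"
    show "g v = None"
    proof (rule ccontr)
      assume "g v \<noteq> None"
      then obtain i where i: "g v = Some i" by blast
      then have "v \<in> {u \<in> V. g u = Some i}" using v by simp
      then have "Poly_Mapping.lookup \<alpha> i \<noteq> 0"
        using V unfolding Some[symmetric] by (simp add: card_eq_0_iff) blast
      then show False using v i by (simp add: in_keys_iff)
    qed
  qed
  have "card (?A w) = fact n * (\<Prod>i\<in>Poly_Mapping.keys \<alpha>. fact (Poly_Mapping.lookup \<alpha> i))"
    if "w \<in> ?W" for w
  proof -
    have "count_list w x = card {v \<in> V. g v = x}" for x
      using that None Some by (cases x) (auto simp: content_eq_iff)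
    from card_arrangements_of_word[OF V _ C this] show ?thesis
      by (simp add: prod.reindex None Some)
  qed
  moreover have "{vs. distinct vs \<and> set vs = V \<and> P (map g vs)} = (\<Union>w\<in>?W. ?A w)"
    using cont by auto
  moreover have "card (\<Union>w\<in>?W. ?A w) = (\<Sum>w\<in>?W. card (?A w))"
    by (rule card_UN_disjoint) (auto simp: finite_arrangements[OF V] intro: finite_subset[OF _ finite_content])
  ultimately show "card {vs. distinct vs \<and> set vs = V \<and> P (map g vs)} =
      fact n * (\<Prod>i\<in>Poly_Mapping.keys \<alpha>. fact (Poly_Mapping.lookup \<alpha> i)) * card ?W"
    by simp
qed

lemma incompatibilities_empty_iff: "incompatibilities w = {} \<longleftrightarrow> cyclically compatible w"
  by (auto simp: incompatibilities_def cyclically_def)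

text \<open>The entries are distinct, so the \<open>N\<close> rotations of a list differ and the
  classes partition \<open>S\<close> into parts of size \<open>N\<close>.\<close>

lemma card_rotation_classes:
  assumes fin: "finite S" and S: "\<And>vs. vs \<in> S \<Longrightarrow> distinct vs \<and> length vs = N" and N: "N > 0"
    and rot: "\<And>vs k. vs \<in> S \<Longrightarrow> rotate k vs \<in> S"
  shows "N * card (rotation_class ` S) = card S"
proof -
  have class_rotate: "rotation_class (rotate k vs) = rotation_class vs" if "vs \<in> S" for vs k
  proof -
    \<comment> \<open>Turning on by \<open>N * k - k\<close> completes the rotation by
      \<open>k\<close> to a multiple of \<open>N\<close>; the subtraction is exact as
      \<open>N > 0\<close>.\<close>
    have "rotate j vs = rotate (j + (N * k - k)) (rotate k vs)" for j
    proof -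
      have "k \<le> N * k" using N by (cases N) simp_all
      then have "j + (N * k - k) + k = j + N * k" by linarith
      then have "rotate (j + (N * k - k)) (rotate k vs) = rotate (j + N * k) vs"
        by (simp only: rotate_rotate)
      also have "\<dots> = rotate j vs"
        using S[OF that] rotate_conv_mod[of "j + N * k" vs] rotate_conv_mod[of j vs] by simp
      finally show ?thesis by simp
    qed
    then have "rotate j vs \<in> rotation_class (rotate k vs)" for j
      unfolding rotation_class_def by blast
    moreover have "rotate j (rotate k vs) \<in> rotation_class vs" for j
      unfolding rotation_class_def rotate_rotate by blast
    ultimately show ?thesis unfolding rotation_class_def by blast
  qed
  have card_class: "card (rotation_class vs) = N" if "vs \<in> S" for vs
  proof -
    have "rotate j vs = rotate (j mod N) vs" for j
      using S[OF that] rotate_conv_mod by blast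
    moreover have "j mod N < N" for j using N by simp
    ultimately have "rotation_class vs = (\<lambda>j. rotate j vs) ` {..<N}"
      unfolding rotation_class_def by blast
    moreover have "inj_on (\<lambda>j. rotate j vs) {..<N}"
    proof (rule inj_onI)
      fix i j assume ij: "i \<in> {..<N}" "j \<in> {..<N}" "rotate i vs = rotate j vs"
      \<comment> \<open>These are the first entries of the two rotations.\<close>
      then have "vs ! i = vs ! j"
        using S[OF that] N nth_rotate[of 0 vs i] nth_rotate[of 0 vs j] by simp
      then show "i = j"
        using ij S[OF that] by (simp add: nth_eq_iff_index_eq)
    qed
    ultimately show ?thesis by (simp add: card_image)
  qed
  have sub: "rotation_class vs \<subseteq> S" if "vs \<in> S" for vs
    using rot[OF that] by (auto simp: rotation_class_def)
  have self: "vs \<in> rotation_class vs" for vs :: "'a list"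
    unfolding rotation_class_def by (metis rangeI rotate0 id_apply)
  have union: "\<Union> (rotation_class ` S) = S"
    using sub self by blast
  have eq: "rotation_class v = rotation_class u" if "v \<in> rotation_class u" "u \<in> S" for u v
    using that(1) class_rotate[OF that(2)] by (metis rotation_class_def rangeE)
  have "N * card (rotation_class ` S) = card (\<Union> (rotation_class ` S))"
  proof (rule card_partition)
    show "c1 \<inter> c2 = {}" if "c1 \<in> rotation_class ` S" "c2 \<in> rotation_class ` S" "c1 \<noteq> c2" for c1 c2
      using that eq by blast
  qed (use fin union card_class in auto)
  then show ?thesis unfolding union .
qed

text \<open>The multiset by which \<open>mono_sym\<close> recognises its monomials.\<close>

definition exponents :: "expo \<Rightarrow> nat multiset"
  where "exponents \<alpha> = image_mset (Poly_Mapping.lookup \<alpha>) (mset_set (Poly_Mapping.keys \<alpha>))"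

text \<open>Block \<open>i\<close> of \<mu> is coloured by the variable \<open>ks ! i\<close>, whose
  exponent is \<open>\<mu> ! i\<close>, and each extra vertex by z. Different parts receive
  different variables, which makes adjacency a condition on colours.\<close>

lemma multipartite_colouring:
  fixes n :: nat
  assumes "exponents \<alpha> = mset \<mu>"
  defines "G \<equiv> complete_multipartite (\<mu> @ replicate n 1)"
  obtains g :: "nat \<times> nat \<Rightarrow> letter" where
    "finite (verts G)" "card {v \<in> verts G. g v = None} = n"
    "\<And>i. card {v \<in> verts G. g v = Some i} = Poly_Mapping.lookup \<alpha> i"
    "\<And>u v. u \<in> verts G \<Longrightarrow> v \<in> verts G \<Longrightarrow> u \<noteq> v \<Longrightarrow> adj G u v \<longleftrightarrow> compatible (g u) (g v)"
    "rat_of_nat (\<Prod>i\<in>Poly_Mapping.keys \<alpha>. fact (Poly_Mapping.lookup \<alpha> i)) = part_fact \<mu>"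
proof -
  obtain ks where ks: "mset ks = mset_set (Poly_Mapping.keys \<alpha>)" "map (Poly_Mapping.lookup \<alpha>) ks = \<mu>"
    using image_mset_eq_mset_imp assms(1) unfolding exponents_def by blast
  have set: "set ks = Poly_Mapping.keys \<alpha>"
    using ks(1) by (metis finite_keys finite_set_mset_mset_set set_mset_mset)
  have dist: "distinct ks"
    using ks(1) by (metis count_mset_set(1) finite_keys distinct_count_atmost_1 count_mset_set' set)
  have len: "length ks = length \<mu>" using ks(2) by auto
  have nth: "\<mu> ! i = Poly_Mapping.lookup \<alpha> (ks ! i)" if "i < length \<mu>" for i
    using that unfolding ks(2)[symmetric] by simp
  define g :: "nat \<times> nat \<Rightarrow> letter"
    where "g v = (if fst v < length \<mu> then Some (ks ! fst v) else None)" for v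
  have V: "verts G = {(i, j). i < length \<mu> + n \<and> j < (if i < length \<mu> then \<mu> ! i else 1)}"
    by (auto simp: G_def complete_multipartite_def nth_append)
  have "verts G = (SIGMA i : {..<length \<mu> + n}. {..<(if i < length \<mu> then \<mu> ! i else 1)})"
    by (auto simp: V)
  then have 1: "finite (verts G)"
    by simp
  have "{v \<in> verts G. g v = None} = {length \<mu>..<length \<mu> + n} \<times> {0}"
    by (auto simp: V g_def)
  then have 2: "card {v \<in> verts G. g v = None} = n"
    by simp
  have 3: "card {v \<in> verts G. g v = Some i} = Poly_Mapping.lookup \<alpha> i" for i
  proof (cases "i \<in> set ks")
    case True
    then obtain k where k: "k < length \<mu>" "ks ! k = i" by (metis in_set_conv_nth len)
    have "{v \<in> verts G. g v = Some i} = {k} \<times> {..<\<mu> ! k}"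
      using k dist len by (auto simp: V g_def nth_eq_iff_index_eq split: if_splits)
    then show ?thesis using k nth by simp
  next
    case False
    then have "{v \<in> verts G. g v = Some i} = {}"
      using len by (auto simp: g_def split: if_splits)
    then show ?thesis using False set by (simp only: card.empty) (simp add: in_keys_iff)
  qed
  have 4: "adj G u v \<longleftrightarrow> compatible (g u) (g v)"
    if uv: "u \<in> verts G" "v \<in> verts G" "u \<noteq> v" for u v
  proof -
    \<comment> \<open>The blocks coloured by z have one vertex each, so distinct vertices of colour
      z lie in different blocks.\<close>
    have "snd u = snd v" if "fst u = fst v" "\<not> fst v < length \<mu>"
      using that uv by (auto simp: V)
    then have "fst u \<noteq> fst v" if "\<not> fst v < length \<mu>"
      using that uv(3) by (metis prod_eqI)
    then show ?thesis
      using dist len by (auto simp: G_def complete_multipartite_def compatible_def g_def nth_eq_iff_index_eq)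
  qed
  have "part_fact \<mu> = prod_list (map (\<lambda>i. fact (Poly_Mapping.lookup \<alpha> i)) ks)"
    by (simp add: part_fact_def o_def flip: ks(2))
  also have "\<dots> = (\<Prod>i\<in>Poly_Mapping.keys \<alpha>. fact (Poly_Mapping.lookup \<alpha> i))"
    unfolding set[symmetric] by (rule prod.distinct_set_conv_list[OF dist, symmetric])
  finally have 5: "rat_of_nat (\<Prod>i\<in>Poly_Mapping.keys \<alpha>. fact (Poly_Mapping.lookup \<alpha> i)) = part_fact \<mu>"
    by simp
  show ?thesis by (rule that[OF 1 2 3 4 5])
qed

text \<open>Consecutive vertices of an ordering are distinct, so adjacency can be read off the
  colours.\<close>

lemma HP_eq:
  assumes "exponents \<alpha> = mset \<mu>"
  shows "rat_of_nat (HP (complete_multipartite (\<mu> @ replicate n 1))) =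
    fact n * part_fact \<mu> * of_nat (card {w. content w = (n, \<alpha>) \<and> successively compatible w})"
proof -
  let ?G = "complete_multipartite (\<mu> @ replicate n 1)"
  obtain g :: "nat \<times> nat \<Rightarrow> letter" where g: "finite (verts ?G)" "card {v \<in> verts ?G. g v = None} = n"
    "\<And>i. card {v \<in> verts ?G. g v = Some i} = Poly_Mapping.lookup \<alpha> i"
    "\<And>u v. u \<in> verts ?G \<Longrightarrow> v \<in> verts ?G \<Longrightarrow> u \<noteq> v \<Longrightarrow> adj ?G u v \<longleftrightarrow> compatible (g u) (g v)"
    "rat_of_nat (\<Prod>i\<in>Poly_Mapping.keys \<alpha>. fact (Poly_Mapping.lookup \<alpha> i)) = part_fact \<mu>"
    using multipartite_colouring[OF assms] by blast
  have "successively (adj ?G) vs \<longleftrightarrow> successively compatible (map g vs)"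
    if "distinct vs" "set vs = verts ?G" for vs
  proof -
    have "adj ?G (vs ! i) (vs ! Suc i) \<longleftrightarrow> compatible (g (vs ! i)) (g (vs ! Suc i))"
      if i: "Suc i < length vs" for i
    proof (rule g(4))
      show "vs ! i \<noteq> vs ! Suc i" using i \<open>distinct vs\<close> by (simp add: nth_eq_iff_index_eq)
      show "vs ! i \<in> verts ?G" "vs ! Suc i \<in> verts ?G"
        using i \<open>set vs = verts ?G\<close> nth_mem Suc_lessD by blast+
    qed
    then show ?thesis by (auto simp: successively_conv_nth)
  qed
  then have "ham_paths ?G =
      {vs. distinct vs \<and> set vs = verts ?G \<and> successively compatible (map g vs)}"
    by (auto simp: ham_paths_def)
  then show ?thesis
    by (simp only: HP_def card_arrangements(1)[OF g(1-3)] of_nat_mult of_nat_fact g(5))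
qed

text \<open>Closed orderings correspond to cyclic words, and each cycle is a class of as many
  rotations as there are vertices. Two adjacent vertices thus give one cycle, as the convention
  wants.\<close>

lemma HC_eq:
  assumes "exponents \<alpha> = mset \<mu>" and weight: "weight (n, \<alpha>) \<ge> 2"
  shows "of_nat (weight (n, \<alpha>)) * rat_of_nat (HC (complete_multipartite (\<mu> @ replicate n 1))) =
    fact n * part_fact \<mu> * of_nat (card {w. content w = (n, \<alpha>) \<and> incompatibilities w = {}})"
proof -
  let ?G = "complete_multipartite (\<mu> @ replicate n 1)" and ?N = "weight (n, \<alpha>)"
  obtain g :: "nat \<times> nat \<Rightarrow> letter" where g: "finite (verts ?G)" "card {v \<in> verts ?G. g v = None} = n"
    "\<And>i. card {v \<in> verts ?G. g v = Some i} = Poly_Mapping.lookup \<alpha> i"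
    "\<And>u v. u \<in> verts ?G \<Longrightarrow> v \<in> verts ?G \<Longrightarrow> u \<noteq> v \<Longrightarrow> adj ?G u v \<longleftrightarrow> compatible (g u) (g v)"
    "rat_of_nat (\<Prod>i\<in>Poly_Mapping.keys \<alpha>. fact (Poly_Mapping.lookup \<alpha> i)) = part_fact \<mu>"
    using multipartite_colouring[OF assms(1)] by blast
  note len = card_arrangements(2)[OF g(1-3)]
  have "vs \<noteq> [] \<and> successively (adj ?G) vs \<and> adj ?G (last vs) (hd vs) \<longleftrightarrow>
      incompatibilities (map g vs) = {}"
    if vs: "distinct vs" "set vs = verts ?G" for vs
  proof -
    have "vs \<noteq> []" using len[OF vs] weight by auto
    have "adj ?G (vs ! i) (vs ! (Suc i mod length vs)) \<longleftrightarrow>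
        compatible (g (vs ! i)) (g (vs ! (Suc i mod length vs)))" if "i < length vs" for i
    proof (rule g(4))
      have l: "Suc i mod length vs < length vs" using that by (intro mod_less_divisor) auto
      \<comment> \<open>This needs at least two vertices: a single one would be its own cyclic
        successor.\<close>
      have "Suc i mod length vs \<noteq> i"
        using len[OF vs] weight that by (auto simp: mod_Suc)
      then show "vs ! i \<noteq> vs ! (Suc i mod length vs)"
        using that l vs(1) by (simp add: nth_eq_iff_index_eq)
      show "vs ! i \<in> verts ?G" "vs ! (Suc i mod length vs) \<in> verts ?G"
        using that l vs(2) nth_mem by blast+
    qed
    moreover have "Suc i mod length vs < length vs" if "i < length vs" for i
      using that by (intro mod_less_divisor) auto
    ultimately have "cyclically (adj ?G) vs \<longleftrightarrow> cyclically compatible (map g vs)"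
      by (simp add: cyclically_def)
    then show ?thesis
      using \<open>vs \<noteq> []\<close> cyclically_iff[of vs "adj ?G"] by (simp add: incompatibilities_empty_iff)
  qed
  then have S: "closed_ham_paths ?G =
      {vs. distinct vs \<and> set vs = verts ?G \<and> incompatibilities (map g vs) = {}}"
    unfolding closed_ham_paths_def ham_paths_def by blast
  have "?N * HC ?G = card (closed_ham_paths ?G)"
    unfolding HC_def
  proof (rule card_rotation_classes)
    show "finite (closed_ham_paths ?G)"
      unfolding S by (rule finite_arrangements[OF g(1)])
    show "distinct vs \<and> length vs = ?N" if "vs \<in> closed_ham_paths ?G" for vs
      using that len unfolding S by blast
    show "rotate k vs \<in> closed_ham_paths ?G" if "vs \<in> closed_ham_paths ?G" for vs k
      using that cyclically_rotate[of compatible "map g vs" k]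
      unfolding S incompatibilities_empty_iff by (simp add: rotate_map)
  qed (use weight in linarith)
  also have "\<dots> = fact n * (\<Prod>i\<in>Poly_Mapping.keys \<alpha>. fact (Poly_Mapping.lookup \<alpha> i)) *
      card {w. content w = (n, \<alpha>) \<and> incompatibilities w = {}}"
    unfolding S by (rule card_arrangements(1)[OF g(1-3)])
  finally have "rat_of_nat (?N * HC ?G) = rat_of_nat (fact n *
      (\<Prod>i\<in>Poly_Mapping.keys \<alpha>. fact (Poly_Mapping.lookup \<alpha> i)) *
      card {w. content w = (n, \<alpha>) \<and> incompatibilities w = {}})"
    by (rule arg_cong)
  then show ?thesis
    by (simp only: of_nat_mult of_nat_fact g(5))
qed

section \<open>From partitions to monomials\<close>

lemma coef_mono_term:
  "coef (mono_term n \<mu>) c =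
    (if fst c = n \<and> exponents (snd c) = mset \<mu> then 1 / (fact n * part_fact \<mu>) else 0)"
proof -
  have "(fps_X ^ n * fps_const (mono_sym \<mu>)) $ fst c = (if fst c = n then mono_sym \<mu> else 0)"
    by (auto simp: fps_X_power_mult_nth)
  then have "coef (fps_X ^ n * fps_const (mono_sym \<mu>)) c =
      (if fst c = n \<and> exponents (snd c) = mset \<mu> then 1 else 0)"
    by (simp add: coef_def zero_symf.rep_eq mono_sym.rep_eq exponents_def)
  then show ?thesis by (simp add: mono_term_def)
qed

text \<open>The one partition whose monomial symmetric function contains the monomial of \<alpha>;
  reversed because partitions decrease.\<close>

definition partition_of :: "expo \<Rightarrow> nat list"
  where "partition_of \<alpha> = rev (sorted_list_of_multiset (exponents \<alpha>))"

lemma is_partition_partition_of: "is_partition (partition_of \<alpha>)"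
proof -
  have "sorted_wrt (\<ge>) (partition_of \<alpha>)"
    unfolding partition_of_def sorted_wrt_rev by (simp add: sorted_sorted_list_of_multiset)
  moreover have "set (partition_of \<alpha>) = Poly_Mapping.lookup \<alpha> ` Poly_Mapping.keys \<alpha>"
    by (simp add: partition_of_def exponents_def)
  ultimately show ?thesis by (auto simp: is_partition_def in_keys_iff)
qed

lemma mset_partition_of: "mset (partition_of \<alpha>) = exponents \<alpha>"
  by (simp add: partition_of_def)

lemma partition_of_unique:
  assumes "is_partition \<mu>" and "exponents \<alpha> = mset \<mu>"
  shows "\<mu> = partition_of \<alpha>"
proof -
  have "sorted (rev \<mu>)" using assms(1) by (simp add: is_partition_def sorted_wrt_rev)
  then have "sorted_list_of_multiset (mset (rev \<mu>)) = rev \<mu>"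
    by (simp only: sorted_list_of_multiset_mset sorted_sort_id)
  then show ?thesis by (simp add: partition_of_def assms(2))
qed

lemma part_fact_pos: "part_fact \<mu> > 0"
  by (induction \<mu>) (simp_all add: part_fact_def)

text \<open>A monomial given by \<open>n\<close> and \<alpha> can occur only in the term of
  \<open>n\<close> and \<open>partition_of \<alpha>\<close>. Hence the sum exists, and the identity
  is checked coefficientwise: on the counts inside \<open>A\<close>, on the vanishing of
  \<open>F\<close> outside.\<close>

lemma formal_sum_mono_terms:
  fixes H :: "nat \<Rightarrow> nat list \<Rightarrow> nat"
  assumes A: "A \<subseteq> {(n, \<mu>). is_partition \<mu>}"
    and H: "\<And>n \<alpha>. (n, partition_of \<alpha>) \<in> A \<Longrightarrow>
      of_nat (H n (partition_of \<alpha>)) = fact n * part_fact (partition_of \<alpha>) * coef F (n, \<alpha>)"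
    and F: "\<And>n \<alpha>. (n, partition_of \<alpha>) \<notin> A \<Longrightarrow> coef F (n, \<alpha>) = 0"
  shows "formally_summable (\<lambda>(n, \<mu>). of_nat (H n \<mu>) * mono_term n \<mu>) A \<and>
    formal_sum (\<lambda>(n, \<mu>). of_nat (H n \<mu>) * mono_term n \<mu>) A = F"
proof -
  let ?t = "\<lambda>(n, \<mu>). of_nat (H n \<mu>) * mono_term n \<mu>"
  have t: "coef (?t (k, \<mu>)) (n, \<alpha>) = (if k = n \<and> \<mu> = partition_of \<alpha> then coef F (n, \<alpha>) else 0)"
    if "(k, \<mu>) \<in> A" for k \<mu> n \<alpha>
  proof (cases "n = k \<and> exponents \<alpha> = mset \<mu>")
    case True
    then have "\<mu> = partition_of \<alpha>" using that A partition_of_unique by blast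
    then show ?thesis
      using that True H[of n \<alpha>] part_fact_pos[of \<mu>]
      by (simp add: coef_of_nat_mult coef_mono_term mset_partition_of)
  next
    case False
    then show ?thesis
      by (auto simp: coef_of_nat_mult coef_mono_term mset_partition_of)
  qed
  have support: "{p \<in> A. coef (?t p) (n, \<alpha>) \<noteq> 0} \<subseteq> {(n, partition_of \<alpha>)} \<inter> A" for n \<alpha>
    using t by (auto split: if_splits)
  have "formally_summable ?t A"
    unfolding formally_summable_def
  proof (intro allI)
    fix n \<alpha>
    show "finite {p \<in> A. scoeff (?t p $ n) \<alpha> \<noteq> 0}"
      using finite_subset[OF support[of n \<alpha>]] by (simp add: coef_def)
  qed
  moreover have "formal_sum ?t A = F"
  proof (rule symf_fps_eqI)
    fix c :: "nat \<times> expo"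
    obtain n \<alpha> where c: "c = (n, \<alpha>)" by (cases c)
    have "coef (formal_sum ?t A) c = (\<Sum>p\<in>{(n, partition_of \<alpha>)} \<inter> A. coef (?t p) c)"
      unfolding coef_formal_sum c by (rule sum.mono_neutral_left[OF _ support]) auto
    also have "\<dots> = coef F c"
    proof (cases "(n, partition_of \<alpha>) \<in> A")
      case True
      then show ?thesis using t[OF True, of n \<alpha>] by (simp add: c)
    next
      case False
      then show ?thesis using F[OF False] by (simp add: c)
    qed
    finally show "coef (formal_sum ?t A) c = coef F c" .
  qed
  ultimately show ?thesis ..
qed

section \<open>Small index pairs and the two identities\<close>

lemma length_partition_of: "length (partition_of \<alpha>) = card (Poly_Mapping.keys \<alpha>)"
  by (metis exponents_def mset_partition_of size_image_mset size_mset size_mset_set)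

lemma card_keys_le_tdeg: "card (Poly_Mapping.keys \<alpha>) \<le> tdeg \<alpha>"
proof -
  have "(\<Sum>i\<in>Poly_Mapping.keys \<alpha>. 1) \<le> (\<Sum>i\<in>Poly_Mapping.keys \<alpha>. Poly_Mapping.lookup \<alpha> i)"
    by (rule sum_mono) (simp add: in_keys_iff Suc_le_eq)
  then show ?thesis by (simp add: tdeg_def)
qed

lemma card_keys_le_1_cases:
  assumes "card (Poly_Mapping.keys \<alpha>) \<le> 1"
  obtains "\<alpha> = 0" | "is_single (0, \<alpha>)"
proof (cases "\<alpha> = 0")
  case False
  then have "card (Poly_Mapping.keys \<alpha>) = 1"
    using assms by (simp add: le_Suc_eq)
  then obtain i where i: "Poly_Mapping.keys \<alpha> = {i}" by (auto simp: card_1_singleton_iff)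
  then have "\<alpha> = Poly_Mapping.single i (Poly_Mapping.lookup \<alpha> i)"
    by (metis (no_types, lifting) in_keys_iff lookup_single_eq lookup_single_not_eq poly_mapping_eqI singleton_iff)
  moreover have "Poly_Mapping.lookup \<alpha> i > 0" using i by (metis in_keys_iff insertI1 gr0I)
  ultimately show ?thesis using that(2) by (auto simp: is_single_def)
qed (use that in simp)

text \<open>All letters equal x_i, so position 0 meets the same letter at its cyclic successor, also
  when the word has length 1.\<close>

lemma no_cyclic_words_of_single:
  assumes "is_single c"
  shows "{w. content w = c \<and> incompatibilities w = {}} = {}"
proof -
  obtain i m where c: "m > 0" "c = (0, Poly_Mapping.single i m)" using assms by (auto simp: is_single_def)
  have "incompatibilities w \<noteq> {}" if w: "content w = c" for w
  proof -
    have "a = Some i" if "a \<in> set w" for a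
    proof (rule ccontr)
      assume "a \<noteq> Some i"
      then have "count_list w a = 0"
        using w c by (cases a) (auto simp: content_eq_iff lookup_single_not_eq)
      then show False using that by (simp add: count_list_0_iff)
    qed
    moreover have "length w > 0" using w c length_eq_weight[of w] by simp
    moreover from this have "Suc 0 mod length w < length w" by (intro mod_less_divisor)
    ultimately have "w ! 0 = Some i" "w ! (Suc 0 mod length w) = Some i"
      using nth_mem by blast+
    then have "0 \<in> incompatibilities w"
      using \<open>length w > 0\<close> by (simp only: incompatibilities_def compatible_def) simp
    then show ?thesis by blast
  qed
  then show ?thesis by blast
qed

lemma coef_ln_1_0: "coef (formal_ln (1 - step_series)) (1, 0) = - 1"
  by (simp add: coef_formal_ln coef_step_series blocks_of_content)

text \<open>Summability is asserted with each identity since a sum with infinitely many nonzero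
  values would be 0 by default. In the second identity the pair \<open>(1, [])\<close> is outside
  the index set, while minus the logarithm contains z with coefficient 1; \<open>- fps_X\<close>
  removes that term.\<close>

theorem theorem5p2p2:
  shows "(formally_summable
        (\<lambda>(n, \<mu>). of_nat (HP (complete_multipartite (\<mu> @ replicate n 1))) * mono_term n \<mu>)
        {(n, \<mu>). is_partition \<mu>} \<and>
      formal_sum
        (\<lambda>(n, \<mu>). of_nat (HP (complete_multipartite (\<mu> @ replicate n 1))) * mono_term n \<mu>)
        {(n, \<mu>). is_partition \<mu>}
      = 1 / (1 - (fps_X + alt_power_sums)))
    \<and>
    (formally_summable
        (\<lambda>(n, \<mu>). of_nat (HC (complete_multipartite (\<mu> @ replicate n 1))) * mono_term n \<mu>)
        {(n, \<mu>). is_partition \<mu> \<and> n + length \<mu> \<ge> 2} \<and>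
      formal_sum
        (\<lambda>(n, \<mu>). of_nat (HC (complete_multipartite (\<mu> @ replicate n 1))) * mono_term n \<mu>)
        {(n, \<mu>). is_partition \<mu> \<and> n + length \<mu> \<ge> 2}
      = - formal_ln (1 - (fps_X + alt_power_sums))
        + formal_sum (\<lambda>n. ((- 1) ^ n / of_nat n) *\<^sub>Q fps_const (power_sum n)) {1..}
        - fps_X)"
  unfolding step_series_def[symmetric]
proof (rule conjI; rule formal_sum_mono_terms)
  fix n :: nat and \<alpha> :: expo
  let ?G = "complete_multipartite (partition_of \<alpha> @ replicate n 1)"
  show "rat_of_nat (HP ?G) = fact n * part_fact (partition_of \<alpha>) * coef (1 / (1 - step_series)) (n, \<alpha>)"
    unfolding HP_eq[OF mset_partition_of[symmetric]] coef_geometric_eq_card ..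
  show "coef (1 / (1 - step_series)) (n, \<alpha>) = 0" if "(n, partition_of \<alpha>) \<notin> {(n, \<mu>). is_partition \<mu>}"
    using that is_partition_partition_of by simp
next
  fix n :: nat and \<alpha> :: expo
  let ?G = "complete_multipartite (partition_of \<alpha> @ replicate n 1)" and ?c = "(n, \<alpha>)"
  let ?A = "{(n, \<mu>). is_partition \<mu> \<and> n + length \<mu> \<ge> 2}"
  let ?F = "- formal_ln (1 - step_series)
      + formal_sum (\<lambda>n. ((- 1) ^ n / of_nat n) *\<^sub>Q fps_const (power_sum n)) {1..} - fps_X"
  let ?W = "{w. content w = ?c \<and> incompatibilities w = {}}"
  have F: "coef ?F ?c = (coef (- formal_ln (1 - step_series)) ?c
      + (if is_single ?c then (- 1) ^ weight ?c / of_nat (weight ?c) else 0))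
      - (if ?c = (1, 0) then 1 else 0)"
    by (simp only: coef_simps coef_sum_power_sums coef_fps_X)
  have F': "coef ?F ?c = of_nat (card ?W) / of_nat (weight ?c) - (if ?c = (1, 0) then 1 else 0)"
    if "weight ?c > 0"
    unfolding F coef_log_eq_card[OF that] ..
  show "rat_of_nat (HC ?G) = fact n * part_fact (partition_of \<alpha>) * coef ?F ?c"
    if "(n, partition_of \<alpha>) \<in> ?A"
  proof -
    have "n + card (Poly_Mapping.keys \<alpha>) \<ge> 2" using that by (simp add: length_partition_of)
    then have w: "weight ?c \<ge> 2" using card_keys_le_tdeg[of \<alpha>] by simp
    then have "?c \<noteq> (1, 0)" and nz: "rat_of_nat (weight ?c) \<noteq> 0"
      by (auto simp del: weight_simps(3)) simp
    have "of_nat (weight ?c) * rat_of_nat (HC ?G) =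
        fact n * part_fact (partition_of \<alpha>) * of_nat (card ?W)"
      by (rule HC_eq[OF mset_partition_of[symmetric] w])
    then have "rat_of_nat (HC ?G) =
        fact n * part_fact (partition_of \<alpha>) * of_nat (card ?W) / of_nat (weight ?c)"
      by (metis nonzero_mult_div_cancel_left nz)
    moreover have "coef ?F ?c = of_nat (card ?W) / of_nat (weight ?c)"
      using F'[OF less_le_trans[OF zero_less_numeral w]] unfolding if_not_P[OF \<open>?c \<noteq> (1, 0)\<close>] by (simp only: diff_zero)
    ultimately show ?thesis by (simp only: times_divide_eq_right)
  qed
  show "coef ?F ?c = 0" if "(n, partition_of \<alpha>) \<notin> ?A"
  proof -
    have le: "n + card (Poly_Mapping.keys \<alpha>) \<le> 1"
      using that by (simp add: is_partition_partition_of length_partition_of)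
    \<comment> \<open>Outside the index set only the monomials z, 1 and x_i^m remain; the right-hand
      side has to vanish at each.\<close>
    have "?c = (1, 0) \<or> ?c = 0 \<or> is_single ?c"
    proof (cases "n = 0")
      case True
      then have "card (Poly_Mapping.keys \<alpha>) \<le> 1" using le by simp
      then show ?thesis
        by (rule card_keys_le_1_cases) (simp_all add: True zero_prod_def)
    next
      case False
      then have "n = 1" "card (Poly_Mapping.keys \<alpha>) = 0" using le by linarith+
      then show ?thesis by simp
    qed
    then consider "?c = (1, 0)" | "?c = 0" | "is_single ?c" by blast
    then show ?thesis
    proof cases
      case 1
      have "\<not> is_single (1, 0)" by (simp add: is_single_def)
      then show ?thesis unfolding F unfolding 1 using coef_ln_1_0 by simp
    next
      case 2
      have "\<not> is_single 0" using weight_pos_of_single[of 0] by auto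
      moreover have "coef (formal_ln (1 - step_series)) 0 = 0" by (simp add: coef_formal_ln)
      moreover have "(0 :: nat \<times> expo) \<noteq> (1, 0)" by (simp add: zero_prod_def)
      ultimately show ?thesis unfolding F unfolding 2 by simp
    next
      case 3
      then have w: "weight ?c > 0" and c: "?c \<noteq> (1, 0)" by (auto simp: is_single_def)
      \<comment> \<open>No cyclic word exists here, so the logarithm and the power sums
        cancel.\<close>
      have "card ?W = 0" using no_cyclic_words_of_single[OF 3] by (simp only: card.empty)
      then show ?thesis unfolding F'[OF w] if_not_P[OF c] by simp
    qed
  qed
qed auto

end
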